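(* (Working in ZF.) Let $\tau$ be a countable non-scattered order type and let $\mathbb{L} = \langle L, < \rangle$ be a linear order. If there is an ordinal $\alpha$ and an injection from the set $L$ into the power set $\mathcal P(\alpha)$, then $\mathbb{L} \not\rightarrow (\tau)^\tau$.
   Context: Order types are isomorphism classes of linear orders; $\eta$ is the order type of the rationals. An order type is scattered if no linear order of that type contains a densely ordered suborder (with at least two elements); for countable $\tau$, non-scattered means a linear order of type $\tau$ contains a suborder of type $\eta$. For a linear order $\mathbb{L}$ and order type $\tau$, $[\mathbb{L}]^\tau$ is the set of subsets of $L$ whose induced order has type $\tau$. $\mathbb{L} \rightarrow (\tau)^\tau$ means: for every $F : [\mathbb{L}]^\tau \to \{0,1\}$ there is $H \in [\mathbb{L}]^\tau$ with $F$ constant on $[H]^\tau$; $\not\rightarrow$ is its negation. *)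

theory Defs
  imports Main
begin

(* HOL proves the axiom of choice, so a statement about HOL types and sets could not express
   provability in ZF: every HOL set injects into the power set of a well-ordered set.
   ZF is therefore rendered by its models: a theorem of ZF is a statement that holds
   in every structure (the type 'v with the relation mem) satisfying the ZF axioms.  Separation and
   replacement range over first-order formulas only; second-order versions would
   import choice from HOL into the model. *)

text \<open>First-order formulas of the language of set theory, with variables named by natural numbers.\<close>

datatype fm =
    Member nat nat
  | Equal nat nat
  | Neg fm
  | Conj fm fm
  | Forall nat fm

(* 'v is the domain of the structure, and its elements are the "sets".  A HOL set of type
   'v set is only a class, used as a notational device: nothing below quantifies over classes,
   and functions, relations and colourings are always elements of 'v. *)

locale set_structure =
  fixes mem :: "'v \<Rightarrow> 'v \<Rightarrow> bool"  (infix "\<in>\<^sub>M" 50)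
begin

primrec sat :: "(nat \<Rightarrow> 'v) \<Rightarrow> fm \<Rightarrow> bool" where
  "sat e (Member i j) \<longleftrightarrow> e i \<in>\<^sub>M e j"
| "sat e (Equal i j) \<longleftrightarrow> e i = e j"
| "sat e (Neg \<phi>) \<longleftrightarrow> \<not> sat e \<phi>"
| "sat e (Conj \<phi> \<psi>) \<longleftrightarrow> sat e \<phi> \<and> sat e \<psi>"
| "sat e (Forall i \<phi>) \<longleftrightarrow> (\<forall>x. sat (e(i := x)) \<phi>)"

definition elts :: "'v \<Rightarrow> 'v set" where
  "elts a = {x. x \<in>\<^sub>M a}"

definition subsets :: "'v \<Rightarrow> 'v set" where
  "subsets a = {x. elts x \<subseteq> elts a}"

definition is_inductive :: "'v \<Rightarrow> bool" where
  "is_inductive w \<longleftrightarrow>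
     (\<exists>z\<in>elts w. elts z = {}) \<and>
     (\<forall>x\<in>elts w. \<exists>y\<in>elts w. elts y = insert x (elts x))"

definition is_omega :: "'v \<Rightarrow> bool" where
  "is_omega w \<longleftrightarrow> is_inductive w \<and> (\<forall>v. is_inductive v \<longrightarrow> elts w \<subseteq> elts v)"

definition is_ordinal :: "'v \<Rightarrow> bool" where
  "is_ordinal a \<longleftrightarrow>
     (\<forall>x\<in>elts a. elts x \<subseteq> elts a) \<and>
     (\<forall>x\<in>elts a. \<not> x \<in>\<^sub>M x) \<and>
     (\<forall>x\<in>elts a. \<forall>y\<in>elts a. \<forall>z\<in>elts a. x \<in>\<^sub>M y \<longrightarrow> y \<in>\<^sub>M z \<longrightarrow> x \<in>\<^sub>M z) \<and>
     (\<forall>x\<in>elts a. \<forall>y\<in>elts a. x \<in>\<^sub>M y \<or> x = y \<or> y \<in>\<^sub>M x) \<and>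
     (\<forall>s\<in>subsets a. elts s \<noteq> {} \<longrightarrow> (\<exists>x\<in>elts s. \<forall>y\<in>elts s. \<not> y \<in>\<^sub>M x))"

(* Kuratowski pairs *)
definition is_pair :: "'v \<Rightarrow> 'v \<Rightarrow> 'v \<Rightarrow> bool" where
  "is_pair p x y \<longleftrightarrow> (\<exists>s t. elts s = {x} \<and> elts t = {x, y} \<and> elts p = {s, t})"

definition related :: "'v \<Rightarrow> 'v \<Rightarrow> 'v \<Rightarrow> bool" where
  "related r x y \<longleftrightarrow> (\<exists>p\<in>elts r. is_pair p x y)"

definition is_function :: "'v \<Rightarrow> 'v set \<Rightarrow> 'v set \<Rightarrow> bool" where
  "is_function f A B \<longleftrightarrow>
     (\<forall>p\<in>elts f. \<exists>x\<in>A. \<exists>y\<in>B. is_pair p x y) \<and>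
     (\<forall>x\<in>A. \<exists>!y. related f x y)"

definition is_injection :: "'v \<Rightarrow> 'v set \<Rightarrow> 'v set \<Rightarrow> bool" where
  "is_injection f A B \<longleftrightarrow> is_function f A B \<and>
     (\<forall>x\<in>A. \<forall>x'\<in>A. \<forall>y. related f x y \<longrightarrow> related f x' y \<longrightarrow> x = x')"

definition is_bijection :: "'v \<Rightarrow> 'v set \<Rightarrow> 'v set \<Rightarrow> bool" where
  "is_bijection f A B \<longleftrightarrow> is_injection f A B \<and> (\<forall>y\<in>B. \<exists>x\<in>A. related f x y)"

definition countable :: "'v \<Rightarrow> bool" where
  "countable a \<longleftrightarrow> (\<exists>w f. is_omega w \<and> is_injection f (elts a) (elts w))"

(* A strict linear order is a set A with a relation r; only r restricted to A matters,
   so for X a subset of A the induced suborder is X with the same r. *)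
definition lin_order :: "'v \<Rightarrow> 'v \<Rightarrow> bool" where
  "lin_order A r \<longleftrightarrow>
     (\<forall>x\<in>elts A. \<not> related r x x) \<and>
     (\<forall>x\<in>elts A. \<forall>y\<in>elts A. \<forall>z\<in>elts A. related r x y \<longrightarrow> related r y z \<longrightarrow> related r x z) \<and>
     (\<forall>x\<in>elts A. \<forall>y\<in>elts A. related r x y \<or> x = y \<or> related r y x)"

definition order_isomorphic :: "'v \<Rightarrow> 'v \<Rightarrow> 'v \<Rightarrow> 'v \<Rightarrow> bool" where
  "order_isomorphic A r B s \<longleftrightarrow> (\<exists>f. is_bijection f (elts A) (elts B) \<and>
     (\<forall>x\<in>elts A. \<forall>x'\<in>elts A. \<forall>y y'. related f x y \<longrightarrow> related f x' y' \<longrightarrow>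
        (related r x x' \<longleftrightarrow> related s y y')))"

definition densely_ordered :: "'v \<Rightarrow> 'v \<Rightarrow> bool" where
  "densely_ordered D r \<longleftrightarrow>
     (\<forall>x\<in>elts D. \<forall>y\<in>elts D. related r x y \<longrightarrow> (\<exists>z\<in>elts D. related r x z \<and> related r z y))"

(* An order type is given by a linear order (T, s) representing it.  The notions "countable"
   and "scattered" are invariant under isomorphism, so they are stated for the representative. *)
definition scattered :: "'v \<Rightarrow> 'v \<Rightarrow> bool" where
  "scattered T s \<longleftrightarrow>
     \<not> (\<exists>D\<in>subsets T. (\<exists>x\<in>elts D. \<exists>y\<in>elts D. x \<noteq> y) \<and> densely_ordered D s)"

definition subsets_of_type :: "'v \<Rightarrow> 'v \<Rightarrow> 'v \<Rightarrow> 'v \<Rightarrow> 'v set" where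
  "subsets_of_type A r T s = {X \<in> subsets A. order_isomorphic X r T s}"

definition two :: "'v set" where
  "two = {c. elts c = {} \<or> (\<exists>z. elts z = {} \<and> elts c = {z})}"

text \<open>The partition relation \<open>\<langle>L, r\<rangle> \<rightarrow> (\<tau>)\<^sup>\<tau>\<close> with two colours, \<open>\<tau>\<close> being the type of \<open>\<langle>T, s\<rangle>\<close>.\<close>

definition arrow :: "'v \<Rightarrow> 'v \<Rightarrow> 'v \<Rightarrow> 'v \<Rightarrow> bool" where
  "arrow L r T s \<longleftrightarrow>
     (\<forall>F. is_function F (subsets_of_type L r T s) two \<longrightarrow>
        (\<exists>H \<in> subsets_of_type L r T s. \<exists>c. \<forall>X \<in> subsets_of_type H r T s. related F X c))"

end

locale ZF = set_structure +
  assumes extensionality: "elts a = elts b \<Longrightarrow> a = b"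
    and foundation: "elts a \<noteq> {} \<Longrightarrow> \<exists>x\<in>elts a. elts x \<inter> elts a = {}"
    and pairing: "\<exists>c. elts c = {a, b}"
    and union: "\<exists>b. elts b = (\<Union>x\<in>elts a. elts x)"
    and power_set: "\<exists>b. elts b = subsets a"
    and infinity: "\<exists>w. is_inductive w"
    and separation: "\<exists>b. elts b = {x \<in> elts a. sat (e(0 := x)) \<phi>}"
    and replacement: "(\<And>x. x \<in> elts a \<Longrightarrow> \<exists>!y. sat (e(0 := x, 1 := y)) \<phi>) \<Longrightarrow>
      \<exists>b. elts b = {y. \<exists>x\<in>elts a. sat (e(0 := x, 1 := y)) \<phi>}"

end

theory Submission
  imports Defs
begin

text \<open>Code the points of \<open>L\<close> by subsets of the ordinal \<open>\<alpha>\<close>.  Two points split at the least ordinal on which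
  their codes differ.  The least level at which a set \<open>X\<close> splits cuts it into two parts, and (as a rule)
  exactly one of the parts is split again at the second level \<open>\<delta>'\<close>.  Give \<open>X\<close> colour 1 iff the other
  part lies below one of the two pieces.

  Let \<open>H\<close> have type \<open>\<tau>\<close>, and let \<open>\<mu>\<close> be least such that some copy \<open>q\<close> of the rationals
  in \<open>H\<close> has all its splitting levels below \<open>\<mu>\<close>.  Then every copy of the rationals in \<open>q\<close> has, at
  each level below \<open>\<mu>\<close>, a non-scattered class of points that agree through that level; otherwise a
  transversal of the classes would contradict the choice of \<open>\<mu>\<close>.  If some splitting of \<open>q\<close> has
  both sides non-scattered, the two sides may be taken one below the other, and by passing to a large class one
  decides which of them splits next; this gives both colours.  If not, the large classes at the various
  levels are nested, and one chooses two points \<open>x0\<close>, \<open>x1\<close>, in either order, that leave them one after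
  the other before the rest of \<open>X\<close> splits; the colour is then decided by whether \<open>x0 < x1\<close>.

  Copies of \<open>\<tau>\<close> and transversals come from one greedy construction along an enumeration in type
  \<open>\<omega>\<close>, which needs no choice.  Comprehension in the model is only available for first-order
  formulas; the predicate \<open>definable\<close>, closed under the logical operations, keeps track of this.\<close>

section \<open>Definable predicates\<close>

text \<open>The codes need not respect the order, or they may respect it too well: a homogeneous set
  could have the side with bit 0 below the other at every splitting, and a colour comparing order
  with bits would then be constant. The second level supplies an orientation that can be steered. It
  singles out the side that splits next, and when both sides are non-scattered, either can be made
  to split next by thinning the other to a class agreeing long enough. The existence of such large
  classes is what the minimality of \<mu> buys. Size is measured by non-scatteredness because
  scattered classes behave like an ideal, and because a non-scattered class has room for any order
  enumerated along omega. The other obstacle is the model. Its omega may be non-standard and HOL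
  functions need not be sets of the model, so recursions and least-element arguments are carried out
  on its elements. The colouring must be fixed before \<open>H\<close> is known, hence uses only the
  order of \<open>L\<close> and the codes; the enumeration of \<open>H\<close>, which replaces
  choice, enters afterwards.\<close>

primrec fvars :: "fm \<Rightarrow> nat set" where
  "fvars (Member i j) = {i, j}"
| "fvars (Equal i j) = {i, j}"
| "fvars (Neg \<phi>) = fvars \<phi>"
| "fvars (Conj \<phi> \<psi>) = fvars \<phi> \<union> fvars \<psi>"
| "fvars (Forall i \<phi>) = fvars \<phi>"

lemma finite_fvars: "finite (fvars \<phi>)"
  by (induction \<phi>) auto

text \<open>\<open>Inl\<close> refers to a variable, \<open>Inr\<close> to a parameter from the
  model. Keeping parameters outside the formula allows a predicate with parameters to be treated
  like one without.\<close>

fun ref :: "(nat \<Rightarrow> 'v) \<Rightarrow> nat + 'v \<Rightarrow> 'v" where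
  "ref e (Inl j) = e j"
| "ref e (Inr c) = c"

definition is_term :: "((nat \<Rightarrow> 'v) \<Rightarrow> 'v) \<Rightarrow> bool" where
  "is_term t \<longleftrightarrow> (\<exists>s. \<forall>e. t e = ref e s)"

lemma is_term_var: "is_term (\<lambda>e. e i)"
  unfolding is_term_def by (rule exI[of _ "Inl i"]) simp

lemma is_term_const: "is_term (\<lambda>e. c)"
  unfolding is_term_def by (rule exI[of _ "Inr c"]) simp

context set_structure
begin

lemma sat_cong: "(\<And>i. i \<in> fvars \<phi> \<Longrightarrow> e i = e' i) \<Longrightarrow> sat e \<phi> = sat e' \<phi>"
proof (induction \<phi> arbitrary: e e')
  case (Neg \<phi>)
  then show ?case by (metis fvars.simps(3) sat.simps(3))
next
  case (Conj \<phi> \<psi>)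
  then show ?case by (metis UnCI fvars.simps(4) sat.simps(4))
next
  case (Forall k \<phi>)
  have "sat (e(k := x)) \<phi> = sat (e'(k := x)) \<phi>" for x
    by (rule Forall.IH) (use Forall.prems in auto)
  then show ?case by simp
qed auto

text \<open>\<open>\<rho>\<close> need not be injective, so a bound variable might be captured. The
  induction therefore runs over all \<open>\<rho>\<close>, and the quantifier case sends the bound
  variable to an index outside the image of the variables in use.\<close>

lemma sat_rename: "\<exists>\<psi>. \<forall>e. sat (\<lambda>i. e (\<rho> i)) \<phi> = sat e \<psi>"
proof (induction \<phi> arbitrary: \<rho>)
  case (Member i j)
  show ?case by (rule exI[of _ "Member (\<rho> i) (\<rho> j)"]) simp
next
  case (Equal i j)
  show ?case by (rule exI[of _ "Equal (\<rho> i) (\<rho> j)"]) simp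
next
  case (Neg \<phi>)
  then show ?case by (metis sat.simps(3))
next
  case (Conj \<phi> \<psi>)
  then show ?case by (metis sat.simps(4))
next
  case (Forall k \<phi>)
  obtain n where n: "n \<notin> \<rho> ` fvars \<phi>"
    using finite_fvars ex_new_if_finite infinite_UNIV_nat by blast
  obtain \<psi> where \<psi>: "\<And>e. sat (\<lambda>i. e ((\<rho>(k := n)) i)) \<phi> = sat e \<psi>"
    using Forall.IH by blast
  have "sat ((\<lambda>i. e (\<rho> i))(k := x)) \<phi> = sat (e(n := x)) \<psi>" for e x
    unfolding \<psi>[symmetric] by (rule sat_cong) (use n in auto)
  then show ?case by (intro exI[of _ "Forall n \<psi>"]) simp
qed

text \<open>Environments are read in de Bruijn style: a quantifier binds index \<open>0\<close> and shifts the rest.\<close>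

definition definable :: "((nat \<Rightarrow> 'v) \<Rightarrow> bool) \<Rightarrow> bool" where
  "definable P \<longleftrightarrow> (\<exists>\<phi> \<sigma>. \<forall>e. P e = sat (\<lambda>i. ref e (\<sigma> i)) \<phi>)"

lemma definable_mem:
  assumes "is_term s" "is_term t"
  shows "definable (\<lambda>e. s e \<in>\<^sub>M t e)"
proof -
  obtain a b where "\<And>e. s e = ref e a" "\<And>e. t e = ref e b"
    using assms unfolding is_term_def by blast
  then show ?thesis unfolding definable_def
    by (intro exI[of _ "Member 0 1"] exI[of _ "\<lambda>i. if i = 0 then a else b"]) simp
qed

lemma definable_eq:
  assumes "is_term s" "is_term t"
  shows "definable (\<lambda>e. s e = t e)"
proof -
  obtain a b where "\<And>e. s e = ref e a" "\<And>e. t e = ref e b"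
    using assms unfolding is_term_def by blast
  then show ?thesis unfolding definable_def
    by (intro exI[of _ "Equal 0 1"] exI[of _ "\<lambda>i. if i = 0 then a else b"]) simp
qed

lemma definable_not: "definable P \<Longrightarrow> definable (\<lambda>e. \<not> P e)"
  unfolding definable_def by (metis sat.simps(3))

lemma definable_conj:
  assumes "definable P" "definable Q"
  shows "definable (\<lambda>e. P e \<and> Q e)"
proof -
  obtain \<phi> \<sigma> \<psi> \<tau> where P: "\<And>e. P e = sat (\<lambda>i. ref e (\<sigma> i)) \<phi>"
    and Q: "\<And>e. Q e = sat (\<lambda>i. ref e (\<tau> i)) \<psi>"
    using assms unfolding definable_def by blast
  \<comment> \<open>Moving the variables of the two formulas to even and odd indices lets a single
    assignment \<open>\<upsilon>\<close> serve both.\<close>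
  obtain \<phi>' where \<phi>': "\<And>e. sat (\<lambda>i. e (2 * i)) \<phi> = sat e \<phi>'"
    using sat_rename[of "\<lambda>i. 2 * i"] by blast
  obtain \<psi>' where \<psi>': "\<And>e. sat (\<lambda>i. e (Suc (2 * i))) \<psi> = sat e \<psi>'"
    using sat_rename[of "\<lambda>i. Suc (2 * i)"] by blast
  define \<upsilon> where "\<upsilon> i = (if even i then \<sigma> (i div 2) else \<tau> (i div 2))" for i
  have "(P e \<and> Q e) = sat (\<lambda>i. ref e (\<upsilon> i)) (Conj \<phi>' \<psi>')" for e
    by (simp add: \<phi>'[symmetric] \<psi>'[symmetric] P Q \<upsilon>_def)
  then show ?thesis unfolding definable_def by blast
qed

text \<open>Applied backwards by \<open>intro\<close>, this form turns the bound variable into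
  \<open>e 0\<close>, and beta reduction shifts all other variables.\<close>

lemma definable_all:
  assumes "definable (\<lambda>e. P (e 0) (\<lambda>i. e (Suc i)))"
  shows "definable (\<lambda>e. \<forall>x. P x e)"
proof -
  obtain \<phi> \<sigma> where P: "\<And>e. P (e 0) (\<lambda>i. e (Suc i)) = sat (\<lambda>i. ref e (\<sigma> i)) \<phi>"
    using assms unfolding definable_def by blast
  obtain \<psi> where \<psi>: "\<And>e. sat (\<lambda>i. e (if \<sigma> i = Inl 0 then 0 else Suc i)) \<phi> = sat e \<psi>"
    using sat_rename[of "\<lambda>i. if \<sigma> i = Inl 0 then 0 else Suc i"] by blast
  \<comment> \<open>The value at 0 is overwritten by the quantifier, and index \<open>Suc i\<close>
    is read only if \<open>\<sigma> i\<close> is not the bound variable \<open>Inl 0\<close>. Hence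
    the truncated \<open>0 - 1\<close> does no harm.\<close>
  define \<tau> where "\<tau> i = (case \<sigma> (i - 1) of Inl j \<Rightarrow> Inl (j - 1) | Inr c \<Rightarrow> Inr c)" for i
  have *: "P x e = sat ((\<lambda>i. ref e (\<tau> i))(0 := x)) \<psi>" for x e
  proof -
    have "(\<lambda>i. ref (case_nat x e) (\<sigma> i)) =
        (\<lambda>i. ((\<lambda>i. ref e (\<tau> i))(0 := x)) (if \<sigma> i = Inl 0 then 0 else Suc i))"
      by (auto simp: \<tau>_def fun_eq_iff split: sum.split nat.split)
    then show ?thesis using P[of "case_nat x e"] unfolding \<psi>[symmetric] by simp
  qed
  show ?thesis unfolding definable_def
    by (intro exI[of _ "Forall 0 \<psi>"] exI[of _ \<tau>]) (simp add: *)
qed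

lemma definable_subst:
  assumes "definable P" "\<And>i. is_term (\<tau> i)"
  shows "definable (\<lambda>e. P (\<lambda>i. \<tau> i e))"
proof -
  obtain \<phi> \<sigma> where P: "\<And>e. P e = sat (\<lambda>i. ref e (\<sigma> i)) \<phi>"
    using assms unfolding definable_def by blast
  obtain s where s: "\<And>i e. \<tau> i e = ref e (s i)"
    using assms(2) unfolding is_term_def by metis
  have "ref (\<lambda>i. \<tau> i e) (\<sigma> i) = ref e (case \<sigma> i of Inl j \<Rightarrow> s j | Inr c \<Rightarrow> Inr c)" for e i
    by (simp add: s split: sum.split)
  then show ?thesis unfolding definable_def P by auto
qed

text \<open>With its binary and ternary versions, this lets the definability of a notion be proved
  once, for the variables 0, 1, 2, and reused for arbitrary variables and parameters.\<close>

lemma definable_subst1: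
  assumes "definable (\<lambda>e. P (e 0))" "is_term t"
  shows "definable (\<lambda>e. P (t e))"
  using definable_subst[OF assms(1), of "\<lambda>_. t"] assms(2) by simp

lemma definable_subst2:
  assumes "definable (\<lambda>e. P (e 0) (e (Suc 0)))" "is_term s" "is_term t"
  shows "definable (\<lambda>e. P (s e) (t e))"
  using definable_subst[OF assms(1), of "\<lambda>i. if i = 0 then s else t"] assms(2,3) by simp

lemma definable_subst3:
  assumes "definable (\<lambda>e. P (e 0) (e (Suc 0)) (e (Suc (Suc 0))))" "is_term s" "is_term t" "is_term u"
  shows "definable (\<lambda>e. P (s e) (t e) (u e))"
  using definable_subst[OF assms(1), of "\<lambda>i. if i = 0 then s else if i = Suc 0 then t else u"]
    assms(2-4) by simp

lemma definable_ex:
  assumes "definable (\<lambda>e. P (e 0) (\<lambda>i. e (Suc i)))"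
  shows "definable (\<lambda>e. \<exists>x. P x e)"
proof -
  have "definable (\<lambda>e. \<not> (\<forall>x. \<not> P x e))"
    by (intro definable_not definable_all assms)
  then show ?thesis by simp
qed

lemma definable_imp:
  assumes "definable P" "definable Q"
  shows "definable (\<lambda>e. P e \<longrightarrow> Q e)"
proof -
  have "definable (\<lambda>e. \<not> (P e \<and> \<not> Q e))"
    by (intro definable_not definable_conj assms)
  then show ?thesis by simp
qed

lemma definable_disj:
  assumes "definable P" "definable Q"
  shows "definable (\<lambda>e. P e \<or> Q e)"
proof -
  have "definable (\<lambda>e. \<not> (\<not> P e \<and> \<not> Q e))"
    by (intro definable_not definable_conj assms)
  then show ?thesis by simp
qed

lemma definable_iff:
  assumes "definable P" "definable Q"
  shows "definable (\<lambda>e. P e \<longleftrightarrow> Q e)"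
  unfolding iff_conv_conj_imp by (intro definable_conj definable_imp assms)

lemma definable_elts: "is_term s \<Longrightarrow> is_term t \<Longrightarrow> definable (\<lambda>e. s e \<in> elts (t e))"
  unfolding elts_def mem_Collect_eq by (rule definable_mem)

lemma definable_ball_elts:
  assumes "is_term t" "definable (\<lambda>e. P (e 0) (\<lambda>i. e (Suc i)))"
  shows "definable (\<lambda>e. \<forall>x\<in>elts (t e). P x e)"
proof -
  obtain s where s: "\<And>e. t e = ref e s" using assms(1) unfolding is_term_def by blast
  have "is_term (\<lambda>e. t (\<lambda>i. e (Suc i)))"
    unfolding is_term_def s
    by (rule exI[of _ "case s of Inl j \<Rightarrow> Inl (Suc j) | Inr c \<Rightarrow> Inr c"]) (simp split: sum.split)
  then show ?thesis unfolding Ball_def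
    by (intro definable_all definable_imp definable_elts assms(2) is_term_var)
qed

lemma definable_bex_elts:
  assumes "is_term t" "definable (\<lambda>e. P (e 0) (\<lambda>i. e (Suc i)))"
  shows "definable (\<lambda>e. \<exists>x\<in>elts (t e). P x e)"
proof -
  have "definable (\<lambda>e. \<not> (\<forall>x\<in>elts (t e). \<not> P x e))"
    by (intro definable_not definable_ball_elts assms)
  then show ?thesis by simp
qed

lemmas definable_logic = definable_eq definable_not definable_conj definable_disj definable_imp
  definable_iff definable_elts definable_ball_elts definable_bex_elts definable_all definable_ex
  definable_mem is_term_var is_term_const

lemma definable_is_pair0: "definable (\<lambda>e. is_pair (e 0) (e (Suc 0)) (e (Suc (Suc 0))))"
  unfolding is_pair_def set_eq_iff insert_iff empty_iff simp_thms by (intro definable_logic)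

lemmas definable_is_pair = definable_subst3[of is_pair, OF definable_is_pair0]

lemma definable_related0: "definable (\<lambda>e. related (e 0) (e (Suc 0)) (e (Suc (Suc 0))))"
  unfolding related_def by (intro definable_logic definable_is_pair)

lemmas definable_related = definable_subst3[of related, OF definable_related0]

end


section \<open>Sets inside a model of ZF\<close>

context ZF
begin

lemma comprehension:
  assumes "definable (\<lambda>e. P (e 0))"
  shows "\<exists>b. elts b = {x \<in> elts a. P x}"
proof -
  obtain \<phi> \<sigma> where P: "\<And>e. P (e 0) = sat (\<lambda>i. ref e (\<sigma> i)) \<phi>"
    using assms unfolding definable_def by blast
  \<comment> \<open>Only \<open>e 0\<close> matters to the predicate, so the constant environment
    with value \<open>x\<close> may be used: every variable collapses to index 0, and the parameter
    of slot \<open>i\<close> is stored at \<open>Suc i\<close>, out of reach of the update at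
    0.\<close>
  define \<rho> where "\<rho> i = (case \<sigma> i of Inl _ \<Rightarrow> 0 | Inr _ \<Rightarrow> Suc i)" for i
  obtain \<psi> where \<psi>: "\<And>e. sat (\<lambda>i. e (\<rho> i)) \<phi> = sat e \<psi>"
    using sat_rename[of \<rho>] by blast
  define c where "c i = (case \<sigma> (i - 1) of Inl _ \<Rightarrow> a | Inr c \<Rightarrow> c)" for i
  have "P x = sat (c(0 := x)) \<psi>" for x
  proof -
    have "(\<lambda>i. ref (\<lambda>_. x) (\<sigma> i)) = (\<lambda>i. (c(0 := x)) (\<rho> i))"
      by (auto simp: \<rho>_def c_def fun_eq_iff split: sum.split)
    then show ?thesis using P[of "\<lambda>_. x"] unfolding \<psi>[symmetric] by simp
  qed
  then show ?thesis using separation[of a c \<psi>] by simp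
qed

lemma union_ex: "\<exists>c. elts c = elts a \<union> elts b"
proof -
  obtain p where "elts p = {a, b}" using pairing by blast
  then show ?thesis using union[of p] by auto
qed

lemma empty_ex: "\<exists>c. elts c = {}"
proof -
  have "definable (\<lambda>e. e 0 \<noteq> e 0)" by (intro definable_logic)
  from comprehension[OF this] show ?thesis by simp
qed

lemma insert_ex: "\<exists>c. elts c = insert x (elts a)"
proof -
  obtain s where "elts s = {x, x}" using pairing by blast
  then show ?thesis using union_ex[of s a] by auto
qed

lemma pair_ex: "\<exists>p. is_pair p x y"
proof -
  obtain s where s: "elts s = {x, x}" using pairing by blast
  obtain t where t: "elts t = {x, y}" using pairing by blast
  obtain p where p: "elts p = {s, t}" using pairing by blast
  have "is_pair p x y"
    unfolding is_pair_def using s t p by (intro exI[of _ s] exI[of _ t]) simp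
  then show ?thesis ..
qed

lemma pair_inject:
  assumes "is_pair p x y" "is_pair p x' y'"
  shows "x = x' \<and> y = y'"
proof -
  obtain s t where e: "elts s = {x}" "elts t = {x, y}" "elts p = {s, t}"
    using assms(1) unfolding is_pair_def by (elim exE conjE)
  obtain s' t' where e': "elts s' = {x'}" "elts t' = {x', y'}" "elts p = {s', t'}"
    using assms(2) unfolding is_pair_def by (elim exE conjE)
  have "{s, t} = {s', t'}" using e(3) e'(3) by (rule subst)
  then have "s = s' \<and> t = t' \<or> s = t' \<and> t = s'" by (simp add: doubleton_eq_iff)
  then show ?thesis
  proof
    assume "s = s' \<and> t = t'"
    then have "{x} = {x'}" "{x, y} = {x', y'}" using e(1,2) e'(1,2) by simp_all
    then show ?thesis by (auto simp: doubleton_eq_iff)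
  next
    assume "s = t' \<and> t = s'"
    then have "{x} = {x', y'}" "{x, y} = {x'}" using e(1,2) e'(1,2) by simp_all
    then show ?thesis by auto
  qed
qed

lemma pair_unique:
  assumes "is_pair p x y" "is_pair p' x y"
  shows "p = p'"
proof -
  obtain s t where e: "elts s = {x}" "elts t = {x, y}" "elts p = {s, t}"
    using assms(1) unfolding is_pair_def by (elim exE conjE)
  obtain s' t' where e': "elts s' = {x}" "elts t' = {x, y}" "elts p' = {s', t'}"
    using assms(2) unfolding is_pair_def by (elim exE conjE)
  have "s = s'" "t = t'" by (rule extensionality, simp add: e e')+
  then have "elts p = elts p'" using e e' by simp
  then show ?thesis by (rule extensionality)
qed

text \<open>Kuratowski pairs lie in the double power set of the union, so separation is
  enough.\<close>

lemma product_ex: "\<exists>c. elts c = {p. \<exists>x\<in>elts a. \<exists>y\<in>elts b. is_pair p x y}"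
proof -
  obtain u where u: "elts u = elts a \<union> elts b" using union_ex by blast
  obtain v where v: "elts v = subsets u" using power_set by blast
  obtain w where w: "elts w = subsets v" using power_set by blast
  have "definable (\<lambda>e. \<exists>x\<in>elts a. \<exists>y\<in>elts b. is_pair (e 0) x y)"
    by (intro definable_logic definable_is_pair)
  from comprehension[OF this]
  obtain c where c: "elts c = {p \<in> elts w. \<exists>x\<in>elts a. \<exists>y\<in>elts b. is_pair p x y}" by blast
  have "p \<in> elts w" if "x \<in> elts a" "y \<in> elts b" "is_pair p x y" for p x y
    using that unfolding w v u subsets_def is_pair_def by auto
  then have "elts c = {p. \<exists>x\<in>elts a. \<exists>y\<in>elts b. is_pair p x y}" unfolding c by blast
  then show ?thesis by blast
qed

lemma relation_comprehension:
  assumes "definable (\<lambda>e. R (e 0) (e (Suc 0)))"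
  shows "\<exists>g. (\<forall>p\<in>elts g. \<exists>x\<in>elts a. \<exists>y\<in>elts b. is_pair p x y) \<and>
    (\<forall>x y. related g x y \<longleftrightarrow> x \<in> elts a \<and> y \<in> elts b \<and> R x y)"
proof -
  obtain c where c: "elts c = {p. \<exists>x\<in>elts a. \<exists>y\<in>elts b. is_pair p x y}"
    using product_ex by blast
  have "definable (\<lambda>e. \<exists>x y. is_pair (e 0) x y \<and> R x y)"
    by (intro definable_logic definable_is_pair definable_subst2[of R, OF assms])
  from comprehension[OF this]
  obtain g where g: "elts g = {p \<in> elts c. \<exists>x y. is_pair p x y \<and> R x y}" by blast
  have "related g x y \<longleftrightarrow> x \<in> elts a \<and> y \<in> elts b \<and> R x y" for x y
    unfolding related_def g c using pair_ex[of x y] by (auto dest: pair_inject)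
  moreover have "\<forall>p\<in>elts g. \<exists>x\<in>elts a. \<exists>y\<in>elts b. is_pair p x y"
    unfolding g c by blast
  ultimately show ?thesis by blast
qed

text \<open>Foundation for the comprehended subset. It serves as the least-element principle for
  both the natural numbers of the model and the levels in \<alpha>.\<close>

lemma minimal_ex:
  assumes "definable (\<lambda>e. P (e 0))" "x \<in> elts a" "P x"
  shows "\<exists>m\<in>elts a. P m \<and> (\<forall>y\<in>elts a. P y \<longrightarrow> y \<notin> elts m)"
proof -
  obtain b where b: "elts b = {x \<in> elts a. P x}" using comprehension[OF assms(1)] by blast
  then have "elts b \<noteq> {}" using assms by auto
  from foundation[OF this] show ?thesis using b by auto
qed

end

section \<open>The order of the natural numbers of the model\<close>

locale omega_in_ZF = ZF mem for mem :: "'v \<Rightarrow> 'v \<Rightarrow> bool"  (infix "\<in>\<^sub>M" 50) +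
  fixes w :: 'v
  assumes omega: "is_omega w"
begin

text \<open>The comprehended subset of \<open>w\<close> is inductive, and \<open>w\<close> is the
  least inductive set. Definability cannot be dropped, since \<open>w\<close> may contain
  non-standard numbers.\<close>

lemma omega_induct [consumes 2, case_names zero suc]:
  assumes "definable (\<lambda>e. P (e 0))" "n \<in> elts w"
    and "\<And>z. elts z = {} \<Longrightarrow> P z"
    and "\<And>n k. n \<in> elts w \<Longrightarrow> P n \<Longrightarrow> elts k = insert n (elts n) \<Longrightarrow> P k"
  shows "P n"
proof -
  obtain v where v: "elts v = {x \<in> elts w. P x}" using comprehension[OF assms(1)] by blast
  have ind: "is_inductive w" using omega unfolding is_omega_def by blast
  have "is_inductive v"
    unfolding is_inductive_def
  proof (intro conjI ballI)
    show "\<exists>z\<in>elts v. elts z = {}"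
      using ind assms(3) unfolding is_inductive_def v by blast
    fix x assume "x \<in> elts v"
    then have x: "x \<in> elts w" "P x" using v by auto
    then obtain y where y: "y \<in> elts w" "elts y = insert x (elts x)"
      using ind unfolding is_inductive_def by blast
    moreover have "P y" using assms(4)[OF x y(2)] .
    ultimately show "\<exists>y\<in>elts v. elts y = insert x (elts x)" using v by blast
  qed
  then have "elts w \<subseteq> elts v" using omega unfolding is_omega_def by blast
  then show ?thesis using assms(2) v by blast
qed

lemma suc_below:
  assumes "m \<in> elts w" "n \<in> elts m" "elts k = insert n (elts n)"
  shows "k \<in> elts m \<or> k = m"
proof -
  \<comment> \<open>The successor equation is written elementwise because
    \<open>definable_logic\<close> treats membership and equality of sets, not equations between
    classes \<open>elts\<close>.\<close>
  define P where "P = (\<lambda>m. \<forall>n\<in>elts m. \<forall>k. (\<forall>z. z \<in> elts k \<longleftrightarrow> z = n \<or> z \<in> elts n)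
    \<longrightarrow> k \<in> elts m \<or> k = m)"
  have "definable (\<lambda>e. P (e 0))" unfolding P_def by (intro definable_logic)
  from this assms(1) have "P m"
  proof (induction rule: omega_induct)
    case (zero z)
    then show ?case by (simp add: P_def)
  next
    case (suc n k)
    show ?case unfolding P_def
    proof (intro ballI allI impI)
      fix x y assume xy: "x \<in> elts k" "\<forall>z. z \<in> elts y \<longleftrightarrow> z = x \<or> z \<in> elts x"
      consider "x = n" | "x \<in> elts n" using xy(1) suc.hyps by auto
      then show "y \<in> elts k \<or> y = k"
      proof cases
        case 1
        then have "y = k" using xy(2) suc.hyps by (auto intro!: extensionality)
        then show ?thesis by simp
      next
        case 2
        then have "y \<in> elts n \<or> y = n" using xy(2) suc.IH unfolding P_def by blast
        then show ?thesis using suc.hyps by blast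
      qed
    qed
  qed
  then show ?thesis using assms unfolding P_def by blast
qed

lemma omega_linear:
  assumes "m \<in> elts w" "n \<in> elts w"
  shows "m \<in> elts n \<or> m = n \<or> n \<in> elts m"
proof -
  have empty_least: "\<forall>z. (\<forall>x. x \<notin> elts z) \<longrightarrow> m = z \<or> z \<in> elts m" if "m \<in> elts w" for m
  proof -
    define Q where "Q = (\<lambda>m. \<forall>z. (\<forall>x. x \<notin> elts z) \<longrightarrow> m = z \<or> z \<in> elts m)"
    have "definable (\<lambda>e. Q (e 0))" unfolding Q_def by (intro definable_logic)
    from this that have "Q m"
    proof (induction rule: omega_induct)
      case (zero z)
      show ?case unfolding Q_def
      proof (intro allI impI)
        fix y assume "\<forall>x. x \<notin> elts y"
        then have "z = y" using zero by (auto intro!: extensionality)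
        then show "z = y \<or> y \<in> elts z" ..
      qed
    next
      case (suc n k)
      show ?case unfolding Q_def
      proof (intro allI impI)
        fix y assume "\<forall>x. x \<notin> elts y"
        then have "n = y \<or> y \<in> elts n" using suc.IH unfolding Q_def by blast
        then show "k = y \<or> y \<in> elts k" using suc.hyps by auto
      qed
    qed
    then show ?thesis unfolding Q_def .
  qed
  define P where "P = (\<lambda>n. \<forall>m\<in>elts w. m \<in> elts n \<or> m = n \<or> n \<in> elts m)"
  have "definable (\<lambda>e. P (e 0))" unfolding P_def by (intro definable_logic)
  from this assms(2) have "P n"
  proof (induction rule: omega_induct)
    case (zero z)
    then have "\<forall>x. x \<notin> elts z" by simp
    then show ?case using empty_least unfolding P_def by blast
  next
    case (suc n k)
    show ?case unfolding P_def
    proof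
      fix m assume m: "m \<in> elts w"
      then have "m \<in> elts n \<or> m = n \<or> n \<in> elts m" using suc.IH unfolding P_def by blast
      moreover have "n \<in> elts m \<Longrightarrow> k \<in> elts m \<or> k = m" using suc_below[OF m _ suc.hyps(2)] .
      ultimately show "m \<in> elts k \<or> m = k \<or> k \<in> elts m" using suc.hyps by auto
    qed
  qed
  then show ?thesis using assms unfolding P_def by blast
qed

end


section \<open>Countable linear orders in the model\<close>

text \<open>Intended: \<open>\<prec>\<close> orders the elements of \<open>h\<close>, and \<open>rk x n\<close> says that \<open>n \<in> \<omega>\<close> is the
  number of \<open>x\<close> in an enumeration of \<open>h\<close>.\<close>

locale coded_order = omega_in_ZF mem w for mem :: "'v \<Rightarrow> 'v \<Rightarrow> bool"  (infix "\<in>\<^sub>M" 50) and w :: 'v +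
  fixes h :: 'v and less :: "'v \<Rightarrow> 'v \<Rightarrow> bool"  (infix "\<prec>" 50) and rk :: "'v \<Rightarrow> 'v \<Rightarrow> bool"
  assumes definable_less0: "definable (\<lambda>e. e 0 \<prec> e (Suc 0))"
    and definable_rk0: "definable (\<lambda>e. rk (e 0) (e (Suc 0)))"
    and less_irrefl: "x \<in> elts h \<Longrightarrow> \<not> x \<prec> x"
    and less_trans: "x \<in> elts h \<Longrightarrow> y \<in> elts h \<Longrightarrow> z \<in> elts h \<Longrightarrow> x \<prec> y \<Longrightarrow> y \<prec> z \<Longrightarrow> x \<prec> z"
    and less_linear: "x \<in> elts h \<Longrightarrow> y \<in> elts h \<Longrightarrow> x \<prec> y \<or> x = y \<or> y \<prec> x"
    and rk_ex: "x \<in> elts h \<Longrightarrow> \<exists>n\<in>elts w. rk x n"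
    and rk_fun: "x \<in> elts h \<Longrightarrow> rk x n \<Longrightarrow> rk x m \<Longrightarrow> n = m"
    and rk_inj: "x \<in> elts h \<Longrightarrow> y \<in> elts h \<Longrightarrow> rk x n \<Longrightarrow> rk y n \<Longrightarrow> x = y"
begin

lemmas definable_less = definable_subst2[of less, OF definable_less0]
lemmas definable_rk = definable_subst2[of rk, OF definable_rk0]

lemma less_asym: "x \<in> elts h \<Longrightarrow> y \<in> elts h \<Longrightarrow> x \<prec> y \<Longrightarrow> \<not> y \<prec> x"
  using less_trans less_irrefl by blast

definition before :: "'v \<Rightarrow> 'v \<Rightarrow> bool" where
  "before x y \<longleftrightarrow> (\<exists>n m. rk x n \<and> rk y m \<and> n \<in> elts m)"

lemma definable_before0: "definable (\<lambda>e. before (e 0) (e (Suc 0)))"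
  unfolding before_def by (intro definable_logic definable_rk)

lemmas definable_before = definable_subst2[of before, OF definable_before0]

lemma before_linear:
  assumes "x \<in> elts h" "y \<in> elts h"
  shows "before x y \<or> x = y \<or> before y x"
  using rk_ex[OF assms(1)] rk_ex[OF assms(2)] omega_linear rk_inj[OF assms]
  unfolding before_def by blast

text \<open>The substitute for choice: among the points with a definable property, one of least rank
  is singled out, and by \<open>before_linear\<close> it is unique.\<close>

lemma before_minimal_ex:
  assumes "definable (\<lambda>e. P (e 0))" "x \<in> elts h" "P x"
  shows "\<exists>m\<in>elts h. P m \<and> (\<forall>y\<in>elts h. P y \<longrightarrow> \<not> before y m)"
proof -
  obtain n where n: "n \<in> elts w" "rk x n" using rk_ex assms(2) by blast
  have "definable (\<lambda>e. \<exists>x\<in>elts h. P x \<and> rk x (e 0))"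
    by (intro definable_logic definable_rk definable_subst1[OF assms(1)])
  from minimal_ex[OF this, of n w] n assms obtain k where
    k: "k \<in> elts w" "\<exists>x\<in>elts h. P x \<and> rk x k" "\<forall>j\<in>elts w. (\<exists>x\<in>elts h. P x \<and> rk x j) \<longrightarrow> j \<notin> elts k"
    by blast
  obtain m where m: "m \<in> elts h" "P m" "rk m k" using k(2) by blast
  have "\<not> before y m" if y: "y \<in> elts h" "P y" for y
  proof
    assume "before y m"
    then obtain i j where ij: "rk y i" "rk m j" "i \<in> elts j" unfolding before_def by blast
    then have "j = k" using rk_fun m by blast
    moreover have "i \<in> elts w" using rk_ex[OF y(1)] rk_fun[OF y(1)] ij(1) by blast
    ultimately show False using k(3) ij y by blast
  qed
  then show ?thesis using m by blast
qed

subsection \<open>Copies of the rationals\<close>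

text \<open>Dense, nonempty and without endpoints; as \<open>rk\<close> makes \<open>h\<close>
  countable, these are the suborders of type \<eta> by Cantor's theorem. Inclusion in
  \<open>h\<close> is spelled out to remain first-order.\<close>

definition etalike :: "'v \<Rightarrow> bool" where
  "etalike d \<longleftrightarrow> (\<forall>x\<in>elts d. x \<in> elts h) \<and> (\<exists>x. x \<in> elts d) \<and>
     (\<forall>x\<in>elts d. (\<exists>y\<in>elts d. y \<prec> x) \<and> (\<exists>y\<in>elts d. x \<prec> y)) \<and>
     (\<forall>x\<in>elts d. \<forall>y\<in>elts d. x \<prec> y \<longrightarrow> (\<exists>z\<in>elts d. x \<prec> z \<and> z \<prec> y))"

text \<open>Only the witness \<open>d\<close> is a set of the model; \<open>P\<close> may be any
  class, so it can be weakened freely without checking definability.\<close>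

definition nonscattered :: "('v \<Rightarrow> bool) \<Rightarrow> bool" where
  "nonscattered P \<longleftrightarrow> (\<exists>d. etalike d \<and> (\<forall>x\<in>elts d. P x))"

lemma definable_etalike0: "definable (\<lambda>e. etalike (e 0))"
  unfolding etalike_def by (intro definable_logic definable_less)

lemmas definable_etalike = definable_subst1[of etalike, OF definable_etalike0]

lemma etalike_subset: "etalike d \<Longrightarrow> x \<in> elts d \<Longrightarrow> x \<in> elts h"
  unfolding etalike_def by blast

lemma etalike_nonempty: "etalike d \<Longrightarrow> \<exists>x. x \<in> elts d"
  unfolding etalike_def by blast

lemma etalike_below: "etalike d \<Longrightarrow> x \<in> elts d \<Longrightarrow> \<exists>y\<in>elts d. y \<prec> x"
  unfolding etalike_def by blast

lemma etalike_above: "etalike d \<Longrightarrow> x \<in> elts d \<Longrightarrow> \<exists>y\<in>elts d. x \<prec> y"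
  unfolding etalike_def by blast

lemma etalike_between:
  "etalike d \<Longrightarrow> x \<in> elts d \<Longrightarrow> y \<in> elts d \<Longrightarrow> x \<prec> y \<Longrightarrow> \<exists>z\<in>elts d. x \<prec> z \<and> z \<prec> y"
  unfolding etalike_def by blast

lemma nonscattered_mono:
  assumes "nonscattered P" "\<And>x. x \<in> elts h \<Longrightarrow> P x \<Longrightarrow> Q x"
  shows "nonscattered Q"
  using assms etalike_subset unfolding nonscattered_def by blast

lemma nonscattered_etalike: "etalike d \<Longrightarrow> nonscattered (\<lambda>x. x \<in> elts d)"
  unfolding nonscattered_def by blast

lemma nonscattered_interval:
  assumes d: "etalike d" and ab: "a \<in> elts d" "b \<in> elts d" "a \<prec> b"
  shows "nonscattered (\<lambda>x. x \<in> elts d \<and> a \<prec> x \<and> x \<prec> b)"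
proof -
  have "definable (\<lambda>e. a \<prec> e 0 \<and> e 0 \<prec> b)" by (intro definable_logic definable_less)
  from comprehension[OF this] obtain c where c: "elts c = {x \<in> elts d. a \<prec> x \<and> x \<prec> b}" by blast
  note sub = etalike_subset[OF d]
  note tr = less_trans[OF sub sub sub]
  have "etalike c" unfolding etalike_def
  proof (intro conjI ballI impI)
    show "\<exists>x. x \<in> elts c" using etalike_between[OF d ab] c by blast
    fix x assume "x \<in> elts c"
    then have x: "x \<in> elts d" "a \<prec> x" "x \<prec> b" using c by auto
    show "x \<in> elts h" using sub x by blast
    obtain y where "y \<in> elts d" "a \<prec> y" "y \<prec> x" using etalike_between[OF d ab(1) x(1,2)] by blast
    then show "\<exists>y\<in>elts c. y \<prec> x" using c tr[of y x b] x ab by blast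
    obtain y where "y \<in> elts d" "x \<prec> y" "y \<prec> b" using etalike_between[OF d x(1) ab(2) x(3)] by blast
    then show "\<exists>y\<in>elts c. x \<prec> y" using c tr[of a x y] x ab by blast
    fix y assume "y \<in> elts c" "x \<prec> y"
    then have y: "y \<in> elts d" "a \<prec> y" "y \<prec> b" "x \<prec> y" using c by auto
    obtain z where "z \<in> elts d" "x \<prec> z" "z \<prec> y" using etalike_between[OF d x(1) y(1,4)] by blast
    then show "\<exists>z\<in>elts c. x \<prec> z \<and> z \<prec> y" using c tr[of a x z] tr[of z y b] x y ab by blast
  qed
  then show ?thesis unfolding nonscattered_def using c by blast
qed

lemma nonscattered_below:
  assumes d: "etalike d" and b: "b \<in> elts d"
  shows "nonscattered (\<lambda>x. x \<in> elts d \<and> x \<prec> b)"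
proof -
  obtain a where a: "a \<in> elts d" "a \<prec> b" using etalike_below[OF assms] by blast
  show ?thesis by (rule nonscattered_mono[OF nonscattered_interval[OF d a(1) b a(2)]]) blast
qed

lemma nonscattered_above:
  assumes d: "etalike d" and a: "a \<in> elts d"
  shows "nonscattered (\<lambda>x. x \<in> elts d \<and> a \<prec> x)"
proof -
  obtain b where b: "b \<in> elts d" "a \<prec> b" using etalike_above[OF assms] by blast
  show ?thesis by (rule nonscattered_mono[OF nonscattered_interval[OF d a b]]) blast
qed

text \<open>If \<open>A\<close> misses an interval of a copy of the rationals, the complement of \<open>A\<close> contains
  that interval; otherwise \<open>A\<close> is itself dense.\<close>

lemma nonscattered_partition:
  assumes P: "nonscattered P" and A: "definable (\<lambda>e. A (e 0))"
  shows "nonscattered (\<lambda>x. P x \<and> A x) \<or> nonscattered (\<lambda>x. P x \<and> \<not> A x)"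
proof -
  obtain d where d: "etalike d" "\<And>x. x \<in> elts d \<Longrightarrow> P x" using P unfolding nonscattered_def by blast
  show ?thesis
  proof (cases "\<exists>a\<in>elts d. \<exists>b\<in>elts d. a \<prec> b \<and> (\<forall>x\<in>elts d. a \<prec> x \<longrightarrow> x \<prec> b \<longrightarrow> \<not> A x)")
    case True
    then obtain a b where ab: "a \<in> elts d" "b \<in> elts d" "a \<prec> b"
      "\<And>x. x \<in> elts d \<Longrightarrow> a \<prec> x \<Longrightarrow> x \<prec> b \<Longrightarrow> \<not> A x" by blast
    have "nonscattered (\<lambda>x. P x \<and> \<not> A x)"
      by (rule nonscattered_mono[OF nonscattered_interval[OF d(1) ab(1-3)]]) (use ab d in blast)
    then show ?thesis ..
  next
    case False
    then have dense: "\<exists>x\<in>elts d. a \<prec> x \<and> x \<prec> b \<and> A x"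
      if "a \<in> elts d" "b \<in> elts d" "a \<prec> b" for a b using that by blast
    obtain c where c: "elts c = {x \<in> elts d. A x}" using comprehension[OF A] by blast
    have "etalike c" unfolding etalike_def
    proof (intro conjI ballI impI)
      obtain a where a: "a \<in> elts d" using etalike_nonempty d by blast
      then obtain b where "b \<in> elts d" "a \<prec> b" using etalike_above d by blast
      then show "\<exists>x. x \<in> elts c" using dense a c by blast
      fix x assume "x \<in> elts c"
      then have x: "x \<in> elts d" using c by blast
      then show "x \<in> elts h" using etalike_subset d by blast
      show "\<exists>y\<in>elts c. y \<prec> x" using etalike_below[OF d(1) x] dense[OF _ x] c by blast
      show "\<exists>y\<in>elts c. x \<prec> y" using etalike_above[OF d(1) x] dense[OF x] c by blast
      fix y assume "y \<in> elts c" "x \<prec> y"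
      then show "\<exists>z\<in>elts c. x \<prec> z \<and> z \<prec> y" using dense[OF x] c by blast
    qed
    then have "nonscattered (\<lambda>x. P x \<and> A x)" unfolding nonscattered_def using c d by blast
    then show ?thesis ..
  qed
qed

lemma nonscattered_two:
  assumes "nonscattered P"
  shows "\<exists>x\<in>elts h. \<exists>y\<in>elts h. P x \<and> P y \<and> x \<prec> y"
proof -
  obtain d where d: "etalike d" "\<And>x. x \<in> elts d \<Longrightarrow> P x" using assms unfolding nonscattered_def by blast
  then show ?thesis using etalike_nonempty[OF d(1)] etalike_above[OF d(1)] etalike_subset[OF d(1)] by blast
qed

lemma nonscattered_remove: "nonscattered P \<Longrightarrow> nonscattered (\<lambda>x. P x \<and> x \<noteq> a)"
proof -
  assume P: "nonscattered P"
  have "definable (\<lambda>e. e 0 = a)" by (intro definable_logic)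
  from nonscattered_partition[OF P this] show ?thesis
  proof
    assume "nonscattered (\<lambda>x. P x \<and> x = a)"
    from nonscattered_two[OF this] show ?thesis using less_irrefl by blast
  qed
qed

lemma nonscattered_split:
  assumes "nonscattered P"
  shows "\<exists>q\<in>elts h. P q \<and> nonscattered (\<lambda>x. P x \<and> x \<prec> q) \<and> nonscattered (\<lambda>x. P x \<and> q \<prec> x)"
proof -
  obtain d where d: "etalike d" "\<And>x. x \<in> elts d \<Longrightarrow> P x" using assms unfolding nonscattered_def by blast
  obtain q where q: "q \<in> elts d" using etalike_nonempty d by blast
  have "nonscattered (\<lambda>x. P x \<and> x \<prec> q)" by (rule nonscattered_mono[OF nonscattered_below[OF d(1) q]]) (use d in blast)
  moreover have "nonscattered (\<lambda>x. P x \<and> q \<prec> x)" by (rule nonscattered_mono[OF nonscattered_above[OF d(1) q]]) (use d in blast)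
  ultimately show ?thesis using d q etalike_subset by blast
qed

text \<open>A point \<open>c\<close> that leaves \<open>P\<close> non-scattered on both sides is
  taken first. \<open>Q\<close> without \<open>c\<close> is non-scattered on one side of
  \<open>c\<close>, and the opposite half of \<open>P\<close> goes with it; which class comes out
  lower cannot be prescribed.\<close>

lemma nonscattered_separate:
  assumes "nonscattered P" "nonscattered Q"
  shows "\<exists>c\<in>elts h. nonscattered (\<lambda>x. P x \<and> x \<prec> c) \<and> nonscattered (\<lambda>x. Q x \<and> c \<prec> x) \<or>
    nonscattered (\<lambda>x. Q x \<and> x \<prec> c) \<and> nonscattered (\<lambda>x. P x \<and> c \<prec> x)"
proof -
  obtain c where c: "c \<in> elts h" "nonscattered (\<lambda>x. P x \<and> x \<prec> c)" "nonscattered (\<lambda>x. P x \<and> c \<prec> x)"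
    using nonscattered_split[OF assms(1)] by blast
  have "definable (\<lambda>e. e 0 \<prec> c)" by (intro definable_logic definable_less)
  from nonscattered_partition[OF nonscattered_remove[OF assms(2), of c] this] show ?thesis
  proof
    assume *: "nonscattered (\<lambda>x. (Q x \<and> x \<noteq> c) \<and> x \<prec> c)"
    have "nonscattered (\<lambda>x. Q x \<and> x \<prec> c)" by (rule nonscattered_mono[OF *]) blast
    then show ?thesis using c by blast
  next
    assume *: "nonscattered (\<lambda>x. (Q x \<and> x \<noteq> c) \<and> \<not> x \<prec> c)"
    have "nonscattered (\<lambda>x. Q x \<and> c \<prec> x)" by (rule nonscattered_mono[OF *]) (use less_linear c in blast)
    then show ?thesis using c by blast
  qed
qed

end

section \<open>The greedy embedding\<close>

text \<open>The partial embedding \<open>p0\<close> is extended one point at a time.  What keeps the construction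
  going is that the set of values still possible at each unused point is non-scattered; since an
  \<open>E\<close>-class is scattered, avoiding it preserves this.\<close>

locale greedy = coded_order +
  fixes E :: "'a \<Rightarrow> 'a \<Rightarrow> bool" and Q p0 :: 'a
  assumes definable_E0: "definable (\<lambda>e. E (e 0) (e (Suc 0)))"
begin

lemmas definable_E = definable_subst2[of E, OF definable_E0]

definition undefd :: "'a \<Rightarrow> 'a \<Rightarrow> bool" where
  "undefd p t \<longleftrightarrow> (\<forall>q. \<not> related p t q)"

definition gap :: "'a \<Rightarrow> 'a \<Rightarrow> 'a \<Rightarrow> bool" where
  "gap p u x \<longleftrightarrow> x \<in> elts Q \<and>
     (\<forall>t q. related p t q \<longrightarrow> (less t u \<longrightarrow> less q x) \<and> (less u t \<longrightarrow> less x q) \<and> \<not> E q x)"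

definition compatible :: "'a \<Rightarrow> bool" where
  "compatible p \<longleftrightarrow> (\<forall>t q t' q'. related p t q \<longrightarrow> related p t' q' \<longrightarrow>
     (t = t' \<longrightarrow> q = q') \<and> (less t t' \<longrightarrow> less q q') \<and> (t \<noteq> t' \<longrightarrow> \<not> E q q'))"

definition extendible :: "'a \<Rightarrow> bool" where
  "extendible p \<longleftrightarrow> (\<forall>u\<in>elts h. undefd p u \<longrightarrow> nonscattered (\<lambda>x. gap p u x))"

definition first :: "'a \<Rightarrow> 'a \<Rightarrow> bool" where
  "first p t \<longleftrightarrow> t \<in> elts h \<and> undefd p t \<and> (\<forall>t'\<in>elts h. undefd p t' \<longrightarrow> \<not> before t' t)"

text \<open>Room on both sides of \<open>q\<close> is demanded because later points may have to be
  inserted just below or just above \<open>t\<close>.\<close>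

definition good :: "'a \<Rightarrow> 'a \<Rightarrow> 'a \<Rightarrow> bool" where
  "good p t q \<longleftrightarrow> gap p t q \<and> nonscattered (\<lambda>x. gap p t x \<and> less x q) \<and> nonscattered (\<lambda>x. gap p t x \<and> less q x)"

text \<open>Least rank makes the value unique, so \<open>step\<close> is a partial function and the
  construction needs no choice.\<close>

definition best :: "'a \<Rightarrow> 'a \<Rightarrow> 'a \<Rightarrow> bool" where
  "best p t q \<longleftrightarrow> good p t q \<and> (\<forall>q'\<in>elts h. good p t q' \<longrightarrow> \<not> before q' q)"

definition step :: "'a \<Rightarrow> 'a \<Rightarrow> bool" where
  "step p p' \<longleftrightarrow> (\<exists>t q. first p t \<and> best p t q \<and>
     (\<forall>z. z \<in> elts p' \<longleftrightarrow> z \<in> elts p \<or> is_pair z t q))"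

lemma definable_undefd0: "definable (\<lambda>e. undefd (e 0) (e (Suc 0)))"
  unfolding undefd_def by (intro definable_logic definable_related)
lemmas definable_undefd = definable_subst2[of undefd, OF definable_undefd0]

lemma definable_gap0: "definable (\<lambda>e. gap (e 0) (e (Suc 0)) (e (Suc (Suc 0))))"
  unfolding gap_def by (intro definable_logic definable_related definable_less definable_E)
lemmas definable_gap = definable_subst3[of gap, OF definable_gap0]

lemma definable_compatible0: "definable (\<lambda>e. compatible (e 0))"
  unfolding compatible_def by (intro definable_logic definable_related definable_less definable_E)

lemma definable_extendible0: "definable (\<lambda>e. extendible (e 0))"
  unfolding extendible_def nonscattered_def
  by (intro definable_logic definable_undefd definable_gap definable_etalike)

lemma definable_first0: "definable (\<lambda>e. first (e 0) (e (Suc 0)))"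
  unfolding first_def by (intro definable_logic definable_undefd definable_before)
lemmas definable_first = definable_subst2[of first, OF definable_first0]

lemma definable_good0: "definable (\<lambda>e. good (e 0) (e (Suc 0)) (e (Suc (Suc 0))))"
  unfolding good_def nonscattered_def by (intro definable_logic definable_gap definable_etalike definable_less)
lemmas definable_good = definable_subst3[of good, OF definable_good0]

lemma definable_best0: "definable (\<lambda>e. best (e 0) (e (Suc 0)) (e (Suc (Suc 0))))"
  unfolding best_def by (intro definable_logic definable_good definable_before)
lemmas definable_best = definable_subst3[of best, OF definable_best0]

lemma definable_step0: "definable (\<lambda>e. step (e 0) (e (Suc 0)))"
  unfolding step_def by (intro definable_logic definable_first definable_best definable_is_pair)
lemmas definable_step = definable_subst2[of step, OF definable_step0]

end

locale greedy_start = greedy +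
  assumes E_sym: "E x y \<Longrightarrow> E y x"
    and E_scattered: "x \<in> elts Q \<Longrightarrow> \<not> nonscattered (\<lambda>y. y \<in> elts Q \<and> E x y)"
    and Q_subset: "x \<in> elts Q \<Longrightarrow> x \<in> elts h"
    and p0_pairs: "z \<in> elts p0 \<Longrightarrow> \<exists>t\<in>elts h. \<exists>q\<in>elts h. is_pair z t q"
    and p0_compatible: "compatible p0"
    and p0_extendible: "extendible p0"
begin

section \<open>One step of the greedy construction and its invariants\<close>

lemma first_unique: "first p t \<Longrightarrow> first p t' \<Longrightarrow> t = t'"
  unfolding first_def using before_linear by blast

lemma good_in: "good p t q \<Longrightarrow> q \<in> elts h"
  unfolding good_def gap_def using Q_subset by blast

lemma best_unique: "best p t q \<Longrightarrow> best p t q' \<Longrightarrow> q = q'"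
  unfolding best_def using before_linear good_in by blast

lemma related_step:
  assumes "\<forall>z. z \<in> elts p' \<longleftrightarrow> z \<in> elts p \<or> is_pair z t q"
  shows "related p' a b \<longleftrightarrow> related p a b \<or> a = t \<and> b = q"
proof -
  obtain z where z: "is_pair z t q" using pair_ex by blast
  show ?thesis unfolding related_def using assms z pair_inject by blast
qed

lemma step_unique:
  assumes "step p p'" "step p p''"
  shows "p' = p''"
proof -
  obtain t q where tq: "first p t" "best p t q" "\<forall>z. z \<in> elts p' \<longleftrightarrow> z \<in> elts p \<or> is_pair z t q"
    using assms(1) unfolding step_def by blast
  obtain t' q' where tq': "first p t'" "best p t' q'" "\<forall>z. z \<in> elts p'' \<longleftrightarrow> z \<in> elts p \<or> is_pair z t' q'"
    using assms(2) unfolding step_def by blast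
  have "t = t'" using first_unique tq(1) tq'(1) .
  moreover from this have "q = q'" using best_unique tq(2) tq'(2) by blast
  ultimately have "elts p' = elts p''" using tq(3) tq'(3) by blast
  then show ?thesis by (rule extensionality)
qed

lemma step_insert:
  assumes "step p p'"
  shows "\<exists>z. elts p' = insert z (elts p)"
proof -
  obtain t q where tq: "\<forall>z. z \<in> elts p' \<longleftrightarrow> z \<in> elts p \<or> is_pair z t q"
    using assms unfolding step_def by blast
  obtain z where z: "is_pair z t q" using pair_ex by blast
  have "elts p' = insert z (elts p)" using tq z pair_unique by blast
  then show ?thesis ..
qed

lemma nonscattered_avoid:
  assumes "nonscattered P" "\<And>x. P x \<Longrightarrow> x \<in> elts Q" "q \<in> elts Q"
  shows "nonscattered (\<lambda>x. P x \<and> \<not> E q x)"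
proof -
  have "definable (\<lambda>e. E q (e 0))" by (intro definable_E is_term_var is_term_const)
  from nonscattered_partition[OF assms(1) this] show ?thesis
  proof
    assume *: "nonscattered (\<lambda>x. P x \<and> E q x)"
    have "nonscattered (\<lambda>x. x \<in> elts Q \<and> E q x)" by (rule nonscattered_mono[OF *]) (use assms(2) in blast)
    then show ?thesis using E_scattered[OF assms(3)] by blast
  qed
qed

definition inside :: "'a \<Rightarrow> bool" where
  "inside p \<longleftrightarrow> (\<forall>z\<in>elts p. \<exists>t\<in>elts h. \<exists>q\<in>elts h. is_pair z t q)"

lemma inside_related: "inside p \<Longrightarrow> related p t q \<Longrightarrow> t \<in> elts h \<and> q \<in> elts h"
  unfolding inside_def related_def using pair_inject by blast

lemma step_inside:
  assumes "inside p" "step p p'"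
  shows "inside p'"
proof -
  obtain t q where tq: "first p t" "best p t q" "\<forall>z. z \<in> elts p' \<longleftrightarrow> z \<in> elts p \<or> is_pair z t q"
    using assms(2) unfolding step_def by blast
  have "t \<in> elts h" "q \<in> elts h" using tq(1,2) good_in unfolding first_def best_def by blast+
  then show ?thesis using assms(1) tq(3) unfolding inside_def by blast
qed

lemma step_compatible:
  assumes p: "inside p" "compatible p" and st: "step p p'"
  shows "compatible p'"
proof -
  obtain t q where tq: "first p t" "best p t q" "\<forall>z. z \<in> elts p' \<longleftrightarrow> z \<in> elts p \<or> is_pair z t q"
    using st unfolding step_def by blast
  have gap: "gap p t q" using tq(2) unfolding best_def good_def by blast
  have th: "t \<in> elts h" "undefd p t" using tq(1) unfolding first_def by blast+
  note rel = related_step[OF tq(3)]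
  show ?thesis unfolding compatible_def rel
  proof (intro allI impI)
    fix a b a' b'
    assume ab: "related p a b \<or> a = t \<and> b = q" and ab': "related p a' b' \<or> a' = t \<and> b' = q"
    consider "related p a b" "related p a' b'" | "related p a b" "a' = t" "b' = q"
      | "a = t" "b = q" "related p a' b'" | "a = t" "b = q" "a' = t" "b' = q"
      using ab ab' by blast
    then show "(a = a' \<longrightarrow> b = b') \<and> (less a a' \<longrightarrow> less b b') \<and> (a \<noteq> a' \<longrightarrow> \<not> E b b')"
    proof cases
      case 1
      then show ?thesis using p(2) unfolding compatible_def by blast
    next
      case 2
      then show ?thesis using gap th(2) unfolding gap_def undefd_def by blast
    next
      case 3
      then show ?thesis using gap th(2) E_sym unfolding gap_def undefd_def by blast
    next
      case 4
      then show ?thesis using less_irrefl[OF th(1)] by blast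
    qed
  qed
qed

lemma step_extendible:
  assumes p: "inside p" "extendible p" and st: "step p p'"
  shows "extendible p'"
proof -
  obtain t q where tq: "first p t" "best p t q" "\<forall>z. z \<in> elts p' \<longleftrightarrow> z \<in> elts p \<or> is_pair z t q"
    using st unfolding step_def by blast
  have gap: "gap p t q" and lo: "nonscattered (\<lambda>x. gap p t x \<and> less x q)" and hi: "nonscattered (\<lambda>x. gap p t x \<and> less q x)"
    using tq(2) unfolding best_def good_def by blast+
  have th: "t \<in> elts h" "undefd p t" using tq(1) unfolding first_def by blast+
  have q: "q \<in> elts Q" "q \<in> elts h" using gap Q_subset unfolding gap_def by blast+
  note rel = related_step[OF tq(3)]
  have gapQ: "gap p v x \<Longrightarrow> x \<in> elts Q" for v x unfolding gap_def by blast
  show ?thesis unfolding extendible_def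
  proof (intro ballI impI)
    fix u assume u: "u \<in> elts h" "undefd p' u"
    then have u': "undefd p u" "u \<noteq> t" using rel unfolding undefd_def by blast+
    have gu: "nonscattered (\<lambda>x. gap p u x)" using p(2) u(1) u'(1) unfolding extendible_def by blast
    have gap': "gap p' u x" if "gap p u x" "\<not> E q x" "less t u \<longrightarrow> less q x" "less u t \<longrightarrow> less x q" for x
      using that unfolding gap_def rel by blast
    \<comment> \<open>It suffices to compare the assigned points below \<open>u\<close> and below
      \<open>t\<close>; those above are then determined by linearity, as neither \<open>u\<close>
      nor \<open>t\<close> is assigned.\<close>
    have same: "gap p u x"
      if x: "gap p t x" and none: "\<And>s. s \<in> elts h \<Longrightarrow> \<not> undefd p s \<Longrightarrow> (less s u \<longleftrightarrow> less s t)" for x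
    proof -
      have "(less s u \<longrightarrow> less r x) \<and> (less u s \<longrightarrow> less x r) \<and> \<not> E r x" if "related p s r" for s r
      proof -
        have s: "s \<in> elts h" "\<not> undefd p s" "s \<noteq> t" "s \<noteq> u"
          using that inside_related[OF p(1)] th(2) u'(1) unfolding undefd_def by blast+
        have "less s u \<longleftrightarrow> less s t" using none s by blast
        moreover from this have "less u s \<longrightarrow> less t s"
          using s th(1) u(1) less_linear[of s t] less_asym[of u s] by blast
        ultimately show ?thesis using x that unfolding gap_def by blast
      qed
      then show ?thesis using x unfolding gap_def by blast
    qed
    consider "less u t" | "less t u" using less_linear[OF u(1) th(1)] u'(2) by blast
    then show "nonscattered (\<lambda>x. gap p' u x)"
    proof cases
      case 1
      have "nonscattered (\<lambda>x. gap p u x \<and> less x q)"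
      proof (cases "\<exists>s\<in>elts h. \<not> undefd p s \<and> less u s \<and> less s t")
        case True
        then obtain s r where s: "s \<in> elts h" "related p s r" "less u s" "less s t"
          unfolding undefd_def by blast
        have r: "r \<in> elts h" using inside_related[OF p(1) s(2)] by blast
        have "less r q" using gap s unfolding gap_def by blast
        moreover have "less x r" if "gap p u x" for x using that s unfolding gap_def by blast
        ultimately have "less x q" if "gap p u x" for x
          using that less_trans[OF _ r q(2)] gapQ Q_subset by blast
        then show ?thesis using gu by (auto elim: nonscattered_mono)
      next
        case False
        have "less s u \<longleftrightarrow> less s t" if s: "s \<in> elts h" "\<not> undefd p s" for s
          using False s less_trans[OF s(1) u(1) th(1)] 1 less_linear[OF s(1) u(1)] u'(1) by blast
        then show ?thesis using same by (intro nonscattered_mono[OF lo]) blast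
      qed
      from nonscattered_avoid[OF this _ q(1)] have "nonscattered (\<lambda>x. (gap p u x \<and> less x q) \<and> \<not> E q x)"
        using gapQ by blast
      then show ?thesis
        by (rule nonscattered_mono) (use gap' less_asym[OF u(1) th(1) 1] in blast)
    next
      case 2
      have "nonscattered (\<lambda>x. gap p u x \<and> less q x)"
      proof (cases "\<exists>s\<in>elts h. \<not> undefd p s \<and> less t s \<and> less s u")
        case True
        then obtain s r where s: "s \<in> elts h" "related p s r" "less t s" "less s u"
          unfolding undefd_def by blast
        have r: "r \<in> elts h" using inside_related[OF p(1) s(2)] by blast
        have "less q r" using gap s unfolding gap_def by blast
        moreover have "less r x" if "gap p u x" for x using that s unfolding gap_def by blast
        ultimately have "less q x" if "gap p u x" for x
          using that less_trans[OF q(2) r] gapQ Q_subset by blast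
        then show ?thesis using gu by (auto elim: nonscattered_mono)
      next
        case False
        have "less s u \<longleftrightarrow> less s t" if s: "s \<in> elts h" "\<not> undefd p s" for s
          using False s less_trans[OF s(1) th(1) u(1)] 2 less_linear[OF s(1) th(1)] th(2) by blast
        then show ?thesis using same by (intro nonscattered_mono[OF hi]) blast
      qed
      from nonscattered_avoid[OF this _ q(1)] have "nonscattered (\<lambda>x. (gap p u x \<and> less q x) \<and> \<not> E q x)"
        using gapQ by blast
      then show ?thesis
        by (rule nonscattered_mono) (use gap' less_asym[OF th(1) u(1) 2] in blast)
    qed
  qed
qed

lemma step_ex:
  assumes p: "extendible p" and t: "first p t"
  shows "\<exists>p'. step p p' \<and> \<not> undefd p' t"
proof -
  have "nonscattered (\<lambda>x. gap p t x)" using p t unfolding extendible_def first_def by blast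
  from nonscattered_split[OF this] obtain q0 where q0: "q0 \<in> elts h" "good p t q0"
    unfolding good_def by blast
  have "definable (\<lambda>e. good p t (e 0))" by (intro definable_good is_term_var is_term_const)
  from before_minimal_ex[OF this q0] obtain q where q: "best p t q" unfolding best_def by blast
  obtain z where z: "is_pair z t q" using pair_ex by blast
  obtain p' where p': "elts p' = insert z (elts p)" using insert_ex by blast
  have el: "\<forall>x. x \<in> elts p' \<longleftrightarrow> x \<in> elts p \<or> is_pair x t q"
    unfolding p' insert_iff using z pair_unique by blast
  then have "step p p'" unfolding step_def using t q by blast
  moreover have "related p' t q" unfolding related_step[OF el] by blast
  ultimately show ?thesis unfolding undefd_def by blast
qed

section \<open>The tower of stages and its union\<close>

definition closed :: "'a \<Rightarrow> bool" where
  "closed c \<longleftrightarrow> p0 \<in> elts c \<and> (\<forall>p\<in>elts c. \<forall>p'. step p p' \<longrightarrow> p' \<in> elts c)"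

lemma definable_closed0: "definable (\<lambda>e. closed (e 0))"
  unfolding closed_def by (intro definable_logic definable_step)

text \<open>The least closed family.  It is taken inside the model, so that induction along it is available
  for definable properties only, but also reaches its non-standard stages.\<close>

definition stage :: "'a \<Rightarrow> bool" where
  "stage p \<longleftrightarrow> inside p \<and> (\<forall>c. closed c \<longrightarrow> p \<in> elts c)"

text \<open>The clause \<open>inside\<close> bounds all stages by the power set of a product. Being
  a set, they can be quantified over in the definable properties used for induction.\<close>

lemma stage_set: "\<exists>S. \<forall>p. p \<in> elts S \<longleftrightarrow> stage p"
proof -
  obtain hh where hh: "elts hh = {p. \<exists>x\<in>elts h. \<exists>y\<in>elts h. is_pair p x y}"
    using product_ex by blast
  obtain ph where ph: "elts ph = subsets hh" using power_set by blast
  have "definable (\<lambda>e. \<forall>c. closed c \<longrightarrow> e 0 \<in> elts c)"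
    by (intro definable_logic definable_subst1[OF definable_closed0])
  from comprehension[OF this]
  obtain S where S: "elts S = {p \<in> elts ph. \<forall>c. closed c \<longrightarrow> p \<in> elts c}" by blast
  have "p \<in> elts ph \<longleftrightarrow> inside p" for p unfolding ph subsets_def hh inside_def by blast
  then have "p \<in> elts S \<longleftrightarrow> stage p" for p unfolding S stage_def by simp
  then show ?thesis by blast
qed

lemma stage_p0: "stage p0"
  unfolding stage_def closed_def inside_def using p0_pairs by blast

lemma stage_step: "stage p \<Longrightarrow> step p p' \<Longrightarrow> stage p'"
  using step_inside unfolding stage_def closed_def by blast

lemma stage_induct [consumes 2, case_names start step]:
  assumes "definable (\<lambda>e. P (e 0))" "stage p" "P p0"
    and "\<And>p p'. stage p \<Longrightarrow> P p \<Longrightarrow> step p p' \<Longrightarrow> P p'"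
  shows "P p"
proof -
  obtain S where S: "\<And>p. p \<in> elts S \<longleftrightarrow> stage p" using stage_set by blast
  obtain c where c: "elts c = {p \<in> elts S. P p}" using comprehension[OF assms(1)] by blast
  have "closed c" unfolding closed_def c
    using S stage_p0 stage_step assms(3,4) by blast
  then have "p \<in> elts c" using assms(2) unfolding stage_def by blast
  then show ?thesis using c by blast
qed

lemma stage_above: "stage p \<Longrightarrow> elts p0 \<subseteq> elts p"
proof -
  assume p: "stage p"
  define P where "P = (\<lambda>p. \<forall>z\<in>elts p0. z \<in> elts p)"
  have "definable (\<lambda>e. P (e 0))" unfolding P_def by (intro definable_logic)
  from this p have "P p"
  proof (induction rule: stage_induct)
    case start
    then show ?case unfolding P_def by blast
  next
    case (step p p')
    then show ?case using step_insert[OF step.hyps(2)] unfolding P_def by blast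
  qed
  then show ?thesis unfolding P_def by blast
qed

text \<open>The tower argument of Zermelo and Bourbaki, with two nested inductions; it works because
  \<open>step\<close> is single-valued and adds one element at a time.\<close>

lemma stage_chain:
  assumes "stage p" "stage q"
  shows "elts p \<subseteq> elts q \<or> elts q \<subseteq> elts p"
proof -
  obtain S where S: "\<And>p. p \<in> elts S \<longleftrightarrow> stage p" using stage_set by blast
  define C where "C = (\<lambda>p. \<forall>q\<in>elts S. (\<forall>z\<in>elts p. z \<in> elts q) \<or> (\<forall>z\<in>elts q. z \<in> elts p))"
  have C: "C p \<longleftrightarrow> (\<forall>q. stage q \<longrightarrow> elts p \<subseteq> elts q \<or> elts q \<subseteq> elts p)" for p
    unfolding C_def S[symmetric] by blast
  have "definable (\<lambda>e. C (e 0))" unfolding C_def by (intro definable_logic)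
  from this assms(1) have "C p"
  proof (induction rule: stage_induct)
    case start
    then show ?case unfolding C using stage_above by blast
  next
    case (step p p')
    obtain y where y: "elts p' = insert y (elts p)" using step_insert[OF step.hyps(2)] by blast
    \<comment> \<open>If \<open>p\<close> is comparable to all stages, no stage lies strictly
      between \<open>p\<close> and its successor.\<close>
    have *: "elts q \<subseteq> elts p \<or> elts p' \<subseteq> elts q" if "stage q" for q
    proof -
      define D where "D = (\<lambda>q. (\<forall>z\<in>elts q. z \<in> elts p) \<or> (\<forall>z\<in>elts p'. z \<in> elts q))"
      have "definable (\<lambda>e. D (e 0))" unfolding D_def by (intro definable_logic)
      from this that have "D q"
      proof (induction rule: stage_induct)
        case start
        then show ?case using stage_above[OF step.hyps(1)] unfolding D_def by blast
      next
        case st: (step q q')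
        obtain x where x: "elts q' = insert x (elts q)" using step_insert[OF st.hyps(2)] by blast
        have "stage q'" using stage_step st.hyps by blast
        then consider "elts q' \<subseteq> elts p" | "elts p \<subseteq> elts q'" using step.IH unfolding C by blast
        then show ?case
        proof cases
          case 1
          then show ?thesis unfolding D_def by blast
        next
          case 2
          consider "elts p' \<subseteq> elts q" | "elts q \<subseteq> elts p" using st.IH unfolding D_def by blast
          then show ?thesis
          proof cases
            case 1
            then show ?thesis using x unfolding D_def by blast
          next
            case qp: 2
            \<comment> \<open>\<open>p\<close> lies between \<open>q\<close> and \<open>q'\<close>,
              which differ by at most one element, so it equals one of them.\<close>
            then have "elts p = elts q \<or> elts p = elts q'"
              using 2 unfolding x by (cases "x \<in> elts p") blast+
            then show ?thesis
            proof
              assume "elts p = elts q"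
              then have "p = q" by (rule extensionality)
              then have "p' = q'" using step_unique st.hyps(2) step.hyps(2) by blast
              then show ?thesis unfolding D_def by blast
            next
              assume "elts p = elts q'"
              then show ?thesis unfolding D_def by blast
            qed
          qed
        qed
      qed
      then show ?thesis unfolding D_def by blast
    qed
    show ?case unfolding C using * y by blast
  qed
  then show ?thesis using assms(2) unfolding C by blast
qed

lemma stage_invariant:
  assumes "stage p"
  shows "compatible p \<and> extendible p"
proof -
  have "definable (\<lambda>e. compatible (e 0) \<and> extendible (e 0))"
    by (intro definable_logic definable_compatible0 definable_extendible0)
  from this assms show ?thesis
  proof (induction rule: stage_induct)
    case start
    then show ?case using p0_compatible p0_extendible by blast
  next
    case (step p p')
    then show ?case using step_compatible step_extendible unfolding stage_def by blast
  qed
qed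

lemma stage_values:
  assumes "stage p" "related p t q"
  shows "q \<in> elts Q \<or> related p0 t q"
proof -
  define V where "V = (\<lambda>p. \<forall>t q. related p t q \<longrightarrow> q \<in> elts Q \<or> related p0 t q)"
  have "definable (\<lambda>e. V (e 0))" unfolding V_def by (intro definable_logic definable_related)
  from this assms(1) have "V p"
  proof (induction rule: stage_induct)
    case start
    then show ?case unfolding V_def by blast
  next
    case (step p p')
    obtain t q where tq: "best p t q" "\<forall>z. z \<in> elts p' \<longleftrightarrow> z \<in> elts p \<or> is_pair z t q"
      using step.hyps(2) unfolding step_def by blast
    have "q \<in> elts Q" using tq(1) unfolding best_def good_def gap_def by blast
    then show ?case using step.IH unfolding V_def related_step[OF tq(2)] by blast
  qed
  then show ?thesis using assms(2) unfolding V_def by blast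
qed

text \<open>Induction on ranks avoids numbering the stages. Once all ranks below \<open>n\<close>
  are served, an unserved point of rank \<open>n\<close> is the \<open>first\<close> one, and a
  single step serves it.\<close>

lemma stage_reaches:
  assumes "n \<in> elts w"
  shows "\<exists>p. stage p \<and> (\<forall>t\<in>elts h. \<forall>m. rk t m \<longrightarrow> m \<in> elts n \<longrightarrow> \<not> undefd p t)"
proof -
  obtain S where S: "\<And>p. p \<in> elts S \<longleftrightarrow> stage p" using stage_set by blast
  define R where "R = (\<lambda>n. \<exists>p\<in>elts S. \<forall>t\<in>elts h. \<forall>m. rk t m \<longrightarrow> m \<in> elts n \<longrightarrow> \<not> undefd p t)"
  have "definable (\<lambda>e. R (e 0))"
    unfolding R_def by (intro definable_logic definable_rk definable_undefd)
  from this assms have "R n"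
  proof (induction rule: omega_induct)
    case (zero z)
    then show ?case unfolding R_def using stage_p0 S by blast
  next
    case (suc n k)
    obtain p where p: "stage p" "\<And>t m. t \<in> elts h \<Longrightarrow> rk t m \<Longrightarrow> m \<in> elts n \<Longrightarrow> \<not> undefd p t"
      using suc.IH S unfolding R_def by blast
    show ?case
    proof (cases "\<exists>t\<in>elts h. rk t n \<and> undefd p t")
      case True
      then obtain t where t: "t \<in> elts h" "rk t n" "undefd p t" by blast
      have "\<not> before s t" if s: "s \<in> elts h" "undefd p s" for s
      proof
        assume "before s t"
        then obtain i j where ij: "rk s i" "rk t j" "i \<in> elts j" unfolding before_def by blast
        then have "j = n" using rk_fun t by blast
        then show False using p(2) s ij by blast
      qed
      then have "first p t" unfolding first_def using t by blast
      then obtain p' where p': "step p p'" "\<not> undefd p' t"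
        using step_ex stage_invariant[OF p(1)] by blast
      obtain y where y: "elts p' = insert y (elts p)" using step_insert[OF p'(1)] by blast
      have "\<not> undefd p' s" if s: "s \<in> elts h" "rk s m" "m \<in> elts k" for s m
      proof (cases "m = n")
        case True
        then show ?thesis using rk_inj t s p' by blast
      next
        case False
        then have "m \<in> elts n" using s(3) unfolding suc.hyps(2) by blast
        then have "\<not> undefd p s" using p(2) s by blast
        then show ?thesis using y unfolding undefd_def related_def by blast
      qed
      then show ?thesis unfolding R_def using S stage_step[OF p(1) p'(1)] by blast
    next
      case False
      then have "\<not> undefd p s" if "s \<in> elts h" "rk s m" "m \<in> elts k" for s m
        using p(2) that unfolding suc.hyps(2) by blast
      then show ?thesis unfolding R_def using S p(1) by blast
    qed
  qed
  then show ?thesis using S unfolding R_def by blast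
qed

text \<open>The union of the stages. Two of its pairs occur together at one stage, since stages form
  a chain, so compatibility is inherited.\<close>

lemma greedy_embedding:
  "\<exists>P. (\<forall>z\<in>elts P. \<exists>t\<in>elts h. \<exists>q\<in>elts h. is_pair z t q) \<and>
     (\<forall>t\<in>elts h. \<exists>q. related P t q) \<and> compatible P \<and>
     (\<forall>t q. related P t q \<longrightarrow> q \<in> elts Q \<or> related p0 t q) \<and>
     (\<forall>t q. related p0 t q \<longrightarrow> related P t q)"
proof -
  obtain S where S: "\<And>p. p \<in> elts S \<longleftrightarrow> stage p" using stage_set by blast
  obtain P where P: "elts P = (\<Union>p\<in>elts S. elts p)" using union by blast
  have rel: "related P t q \<longleftrightarrow> (\<exists>p. stage p \<and> related p t q)" for t q
    unfolding related_def P UN_iff S[symmetric] by blast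
  have "\<exists>q. related P t q" if t: "t \<in> elts h" for t
  proof -
    obtain n where n: "n \<in> elts w" "rk t n" using rk_ex t by blast
    have "is_inductive w" using omega unfolding is_omega_def by blast
    \<comment> \<open>\<open>stage_reaches\<close> covers ranks strictly below its argument, hence
      the successor of \<open>n\<close>.\<close>
    then obtain k where k: "k \<in> elts w" "elts k = insert n (elts n)"
      using n unfolding is_inductive_def by blast
    then have "n \<in> elts k" by blast
    then show ?thesis
      using stage_reaches[OF k(1)] t n(2) rel unfolding undefd_def by blast
  qed
  moreover have "compatible P" unfolding compatible_def
  proof (intro allI impI)
    fix a b a' b' assume ab: "related P a b" "related P a' b'"
    then obtain p p' where p: "stage p" "related p a b" "stage p'" "related p' a' b'"
      unfolding rel by blast
    have "\<exists>p. stage p \<and> related p a b \<and> related p a' b'"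
      using stage_chain[OF p(1,3)] p unfolding related_def by blast
    then show "(a = a' \<longrightarrow> b = b') \<and> (less a a' \<longrightarrow> less b b') \<and> (a \<noteq> a' \<longrightarrow> \<not> E b b')"
      using stage_invariant unfolding compatible_def by blast
  qed
  moreover have "\<forall>z\<in>elts P. \<exists>t\<in>elts h. \<exists>q\<in>elts h. is_pair z t q"
    using S unfolding P stage_def inside_def by blast
  moreover have "\<forall>t q. related P t q \<longrightarrow> q \<in> elts Q \<or> related p0 t q"
    using stage_values unfolding rel by blast
  moreover have "\<forall>t q. related p0 t q \<longrightarrow> related P t q"
    using stage_p0 unfolding rel by blast
  ultimately show ?thesis by blast
qed

end

section \<open>Transversals, and copies through two prescribed points\<close>

context coded_order
begin

definition embedding :: "'v \<Rightarrow> bool" where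
  "embedding P \<longleftrightarrow> (\<forall>z\<in>elts P. \<exists>t\<in>elts h. \<exists>q\<in>elts h. is_pair z t q) \<and>
     (\<forall>t\<in>elts h. \<exists>q. related P t q) \<and>
     (\<forall>t q t' q'. related P t q \<longrightarrow> related P t' q' \<longrightarrow> (t = t' \<longrightarrow> q = q') \<and> (t \<prec> t' \<longrightarrow> q \<prec> q'))"

text \<open>The ranges of order embeddings of \<open>h\<close> into itself; when \<open>h\<close>
  has type \<tau>, they have type \<tau> again.\<close>

definition copy :: "'v \<Rightarrow> bool" where
  "copy X \<longleftrightarrow> (\<exists>P. embedding P \<and> (\<forall>q. q \<in> elts X \<longleftrightarrow> (\<exists>t. related P t q)))"

lemma embedding_related:
  assumes "embedding P" "related P t q"
  shows "t \<in> elts h \<and> q \<in> elts h"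
proof -
  have "\<forall>z\<in>elts P. \<exists>t\<in>elts h. \<exists>q\<in>elts h. is_pair z t q"
    using assms(1) unfolding embedding_def by blast
  then show ?thesis using assms(2) pair_inject unfolding related_def by blast
qed

lemma copy_subset: "copy X \<Longrightarrow> x \<in> elts X \<Longrightarrow> x \<in> elts h"
  unfolding copy_def using embedding_related by blast

text \<open>The greedy construction from the empty map, with values in \<open>d\<close>: since each
  new value avoids the \<open>E\<close>-classes of the old ones, the range is a transversal.\<close>

lemma transversal_ex:
  assumes h: "nonscattered (\<lambda>x. x \<in> elts h)" and d: "etalike d"
    and E: "definable (\<lambda>e. E (e 0) (e (Suc 0)))" "\<And>x y. E x y \<Longrightarrow> E y x"
    and small: "\<And>x. x \<in> elts d \<Longrightarrow> \<not> nonscattered (\<lambda>y. y \<in> elts d \<and> E x y)"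
  shows "\<exists>c. etalike c \<and> (\<forall>x\<in>elts c. x \<in> elts d) \<and> (\<forall>x\<in>elts c. \<forall>y\<in>elts c. x \<noteq> y \<longrightarrow> \<not> E x y)"
proof -
  obtain p0 where p0: "elts p0 = {}" using empty_ex by blast
  then have p0_related: "\<not> related p0 t q" for t q unfolding related_def by simp
  interpret greedy mem w h less rk E d p0 by unfold_locales (rule E(1))
  have gap: "gap p0 u x" if "x \<in> elts d" for u x
    unfolding gap_def using p0_related that by blast
  have ext: "extendible p0"
    unfolding extendible_def by (intro ballI impI nonscattered_mono[OF nonscattered_etalike[OF d]] gap)
  have comp: "compatible p0" unfolding compatible_def using p0_related by blast
  interpret greedy_start mem w h less rk E d p0
    by unfold_locales (use E(2) small etalike_subset[OF d] p0 ext comp in auto)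
  from greedy_embedding p0_related obtain P where P: "\<forall>z\<in>elts P. \<exists>t\<in>elts h. \<exists>q\<in>elts h. is_pair z t q"
    "\<forall>t\<in>elts h. \<exists>q. related P t q" "compatible P" "\<And>t q. related P t q \<Longrightarrow> q \<in> elts d"
    by metis
  obtain f where f: "etalike f" using h unfolding nonscattered_def by blast
  \<comment> \<open>The range of \<open>P\<close> is only a copy of \<open>h\<close>, which need not
    be dense. The image of a copy \<open>f\<close> of the rationals is.\<close>
  have "definable (\<lambda>e. \<exists>t\<in>elts f. related P t (e 0))" by (intro definable_logic definable_related)
  from comprehension[OF this] obtain c where c: "elts c = {x \<in> elts d. \<exists>t\<in>elts f. related P t x}" by blast
  have cI: "x \<in> elts c" if "t \<in> elts f" "related P t x" for t x using that P(4) unfolding c by blast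
  have mono: "less q q'" if "related P t q" "related P t' q'" "less t t'" for t q t' q'
    using P(3) that unfolding compatible_def by blast
  have fh: "t \<in> elts h" if "t \<in> elts f" for t using etalike_subset[OF f that] .
  have val: "\<exists>x\<in>elts c. related P t x" if "t \<in> elts f" for t
    using P(2) fh[OF that] cI[OF that] by blast
  have "etalike c" unfolding etalike_def
  proof (intro conjI ballI impI)
    show "\<exists>x. x \<in> elts c" using etalike_nonempty[OF f] val by blast
    fix x assume x: "x \<in> elts c"
    then obtain t where t: "t \<in> elts f" "related P t x" unfolding c by blast
    show "x \<in> elts h" using x etalike_subset[OF d] unfolding c by blast
    show "\<exists>y\<in>elts c. less y x" using etalike_below[OF f t(1)] val mono t(2) by blast
    show "\<exists>y\<in>elts c. less x y" using etalike_above[OF f t(1)] val mono t(2) by blast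
    fix y assume y: "y \<in> elts c" "less x y"
    then obtain s where s: "s \<in> elts f" "related P s y" unfolding c by blast
    have xy: "x \<in> elts h" "y \<in> elts h" using x y etalike_subset[OF d] unfolding c by blast+
    have "less t s"
    proof (rule ccontr)
      assume "\<not> less t s"
      then consider "s = t" | "less s t" using less_linear fh s t by blast
      then show False
      proof cases
        case 1
        then have "x = y" using P(3) t(2) s(2) unfolding compatible_def by blast
        then show False using y(2) less_irrefl xy by blast
      next
        case 2
        then show False using mono[OF s(2) t(2)] less_asym xy y(2) by blast
      qed
    qed
    then obtain r where "r \<in> elts f" "less t r" "less r s" using etalike_between[OF f t(1) s(1)] by blast
    then show "\<exists>z\<in>elts c. less x z \<and> less z y" using val mono t(2) s(2) by blast
  qed
  moreover have "\<not> E x y" if xy: "x \<in> elts c" "y \<in> elts c" "x \<noteq> y" for x y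
  proof -
    obtain t s where "related P t x" "related P s y" using xy(1,2) unfolding c by blast
    then show ?thesis using P(3) xy(3) unfolding compatible_def by blast
  qed
  moreover have "\<forall>x\<in>elts c. x \<in> elts d" unfolding c by blast
  ultimately show ?thesis by blast
qed

text \<open>The greedy construction started from a map with two pairs, sending \<open>t\<close> to
  \<open>u\<close> and \<open>t'\<close> to \<open>v\<close>. The classes \<open>A\<close>,
  \<open>B\<close>, \<open>C\<close> keep the three gaps non-scattered at the start.\<close>

lemma copy_through_two_points:
  assumes h: "nonscattered (\<lambda>x. x \<in> elts h)" and uv: "u \<in> elts h" "v \<in> elts h" "u \<prec> v"
    and A: "nonscattered A" "\<And>x. A x \<Longrightarrow> x \<prec> u"
    and B: "nonscattered B" "\<And>x. B x \<Longrightarrow> u \<prec> x \<and> x \<prec> v"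
    and C: "nonscattered C" "\<And>x. C x \<Longrightarrow> v \<prec> x"
  shows "\<exists>X. copy X \<and> u \<in> elts X \<and> v \<in> elts X \<and>
    (\<forall>x\<in>elts X. x = u \<or> x = v \<or> A x \<or> B x \<or> C x) \<and> (\<exists>x\<in>elts X. A x) \<and> (\<exists>x\<in>elts X. C x)"
proof -
  obtain a where a: "etalike a" "\<And>x. x \<in> elts a \<Longrightarrow> A x" using A(1) unfolding nonscattered_def by blast
  obtain b where b: "etalike b" "\<And>x. x \<in> elts b \<Longrightarrow> B x" using B(1) unfolding nonscattered_def by blast
  obtain c where c: "etalike c" "\<And>x. x \<in> elts c \<Longrightarrow> C x" using C(1) unfolding nonscattered_def by blast
  obtain ab where ab: "elts ab = elts a \<union> elts b" using union_ex by blast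
  obtain Q where Q: "elts Q = elts ab \<union> elts c" using union_ex by blast
  obtain f where f: "etalike f" using h unfolding nonscattered_def by blast
  obtain t where t: "t \<in> elts f" using etalike_nonempty f by blast
  \<comment> \<open>\<open>h\<close> may have endpoints. Taking the preimages inside
    \<open>f\<close> leaves a point \<open>t0\<close> below and a point \<open>t1\<close> above
    them, and their values witness that \<open>X\<close> meets \<open>A\<close> and
    \<open>C\<close>.\<close>
  obtain t0 where t0: "t0 \<in> elts f" "t0 \<prec> t" using etalike_below[OF f t] by blast
  obtain t' where t': "t' \<in> elts f" "t \<prec> t'" using etalike_above[OF f t] by blast
  obtain t1 where t1: "t1 \<in> elts f" "t' \<prec> t1" using etalike_above[OF f t'(1)] by blast
  have th: "t \<in> elts h" "t' \<in> elts h" "t0 \<in> elts h" "t1 \<in> elts h"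
    using etalike_subset[OF f] t t' t0 t1 by blast+
  have "definable (\<lambda>e. e 0 = t \<and> e (Suc 0) = u \<or> e 0 = t' \<and> e (Suc 0) = v)"
    by (intro definable_logic)
  from relation_comprehension[OF this, of h h] obtain p0 where
    p0: "\<forall>p\<in>elts p0. \<exists>x\<in>elts h. \<exists>y\<in>elts h. is_pair p x y"
    and p0': "\<forall>x y. related p0 x y \<longleftrightarrow> x \<in> elts h \<and> y \<in> elts h \<and> (x = t \<and> y = u \<or> x = t' \<and> y = v)"
    by (elim exE conjE)
  have p0_related: "related p0 x y \<longleftrightarrow> x = t \<and> y = u \<or> x = t' \<and> y = v" for x y
    using uv(1,2) th(1,2) by (auto simp: p0')
  \<comment> \<open>With equality as \<open>E\<close>, avoiding classes just means
    injectivity.\<close>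
  have "definable (\<lambda>e. e 0 = e (Suc 0))" by (intro definable_logic)
  then interpret greedy mem w h less rk "(=)" Q p0 by unfold_locales
  have ne: "t \<noteq> t'" "u \<noteq> v" using t' uv less_irrefl th by blast+
  have nt: "\<not> t' \<prec> t" "\<not> t \<prec> t" "\<not> t' \<prec> t'" using less_asym less_irrefl th t' by blast+
  have comp: "compatible p0"
    unfolding compatible_def p0_related using ne nt uv(3) by blast
  have ext: "extendible p0" unfolding extendible_def
  proof (intro ballI impI)
    fix x assume x: "x \<in> elts h" "undefd p0 x"
    then have xt: "x \<noteq> t" "x \<noteq> t'" unfolding undefd_def p0_related by blast+
    have gap: "gap p0 x y" if "y \<in> elts Q" "u \<noteq> y" "v \<noteq> y" "t \<prec> x \<longrightarrow> u \<prec> y" "x \<prec> t \<longrightarrow> y \<prec> u"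
      "t' \<prec> x \<longrightarrow> v \<prec> y" "x \<prec> t' \<longrightarrow> y \<prec> v" for y
      using that unfolding gap_def p0_related by blast
    consider "x \<prec> t" | "t \<prec> x" "x \<prec> t'" | "t' \<prec> x" using less_linear x(1) th xt by blast
    then show "nonscattered (\<lambda>y. gap p0 x y)"
    proof cases
      case 1
      then have 2: "\<not> t \<prec> x" "x \<prec> t'" "\<not> t' \<prec> x"
        using less_asym less_trans[OF x(1) th(1,2)] t' x(1) th by blast+
      show ?thesis
      proof (rule nonscattered_mono[OF nonscattered_etalike[OF a(1)]])
        fix y assume y: "y \<in> elts h" "y \<in> elts a"
        then have "y \<prec> u" "y \<prec> v" using A(2) a(2) less_trans[OF y(1) uv(1,2)] uv by blast+
        moreover have "u \<noteq> y" "v \<noteq> y" using calculation less_irrefl uv by blast+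
        ultimately show "gap p0 x y" using 1 2 y(2) ab Q by (intro gap) auto
      qed
    next
      case 2
      then have 3: "\<not> x \<prec> t" "\<not> t' \<prec> x" using less_asym x(1) th by blast+
      show ?thesis
      proof (rule nonscattered_mono[OF nonscattered_etalike[OF b(1)]])
        fix y assume y: "y \<in> elts h" "y \<in> elts b"
        then have "u \<prec> y" "y \<prec> v" using B(2) b(2) by blast+
        moreover have "u \<noteq> y" "v \<noteq> y" using calculation less_irrefl uv by blast+
        ultimately show "gap p0 x y" using 2 3 y(2) ab Q by (intro gap) auto
      qed
    next
      case 3
      then have 2: "t \<prec> x" "\<not> x \<prec> t'" "\<not> x \<prec> t"
        using less_asym less_trans[OF th(1,2) x(1)] t' x(1) th by blast+
      show ?thesis
      proof (rule nonscattered_mono[OF nonscattered_etalike[OF c(1)]])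
        fix y assume y: "y \<in> elts h" "y \<in> elts c"
        then have "u \<prec> y" "v \<prec> y" using C(2) c(2) less_trans[OF uv(1,2) y(1)] uv by blast+
        moreover have "u \<noteq> y" "v \<noteq> y" using calculation less_irrefl uv by blast+
        ultimately show "gap p0 x y" using 3 2 y(2) ab Q by (intro gap) auto
      qed
    qed
  qed
  have Qh: "x \<in> elts h" if "x \<in> elts Q" for x
    using that etalike_subset[OF a(1)] etalike_subset[OF b(1)] etalike_subset[OF c(1)] Q ab by blast
  have sing: "\<not> nonscattered (\<lambda>y. y \<in> elts Q \<and> x = y)" for x
    using nonscattered_two[of "\<lambda>y. y \<in> elts Q \<and> x = y"] less_irrefl by blast
  interpret greedy_start mem w h less rk "(=)" Q p0
    by unfold_locales (use sing Qh p0 comp ext in auto)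
  from greedy_embedding obtain P where P: "\<forall>z\<in>elts P. \<exists>t\<in>elts h. \<exists>q\<in>elts h. is_pair z t q"
    "\<And>t. t \<in> elts h \<Longrightarrow> \<exists>q. related P t q" "compatible P"
    "\<And>t q. related P t q \<Longrightarrow> q \<in> elts Q \<or> related p0 t q"
    "\<And>t q. related p0 t q \<Longrightarrow> related P t q"
    by blast
  have emb: "embedding P" unfolding embedding_def using P(1,2,3) unfolding compatible_def by blast
  have "definable (\<lambda>e. \<exists>t. related P t (e 0))" by (intro definable_logic definable_related)
  from comprehension[OF this] obtain X where "elts X = {x \<in> elts h. \<exists>t. related P t x}" by blast
  then have X: "x \<in> elts X \<longleftrightarrow> (\<exists>t. related P t x)" for x using embedding_related[OF emb] by blast
  have Pt: "related P t u" "related P t' v" using P(5) unfolding p0_related by blast+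
  have mono: "q \<prec> q'" if "related P s q" "related P s' q'" "s \<prec> s'" for s q s' q'
    using P(3) that unfolding compatible_def by blast
  have XQ: "x = u \<or> x = v \<or> A x \<or> B x \<or> C x" if "x \<in> elts X" for x
    using that P(4) a(2) b(2) c(2) Q ab unfolding X p0_related by blast
  have "\<exists>x\<in>elts X. A x"
  proof -
    obtain x where x: "related P t0 x" using P(2) th by blast
    then have xX: "x \<in> elts X" "x \<in> elts h" "x \<prec> u"
      using X embedding_related[OF emb] mono[OF x Pt(1) t0(2)] by blast+
    then have "\<not> u \<prec> x" "\<not> v \<prec> x" "x \<noteq> u" "x \<noteq> v"
      using less_asym less_trans[OF xX(2) uv(1,2)] less_irrefl uv by blast+
    then show ?thesis using XQ[OF xX(1)] B(2) C(2) xX(1) by blast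
  qed
  moreover have "\<exists>x\<in>elts X. C x"
  proof -
    obtain x where x: "related P t1 x" using P(2) th by blast
    then have xX: "x \<in> elts X" "x \<in> elts h" "v \<prec> x"
      using X embedding_related[OF emb] mono[OF Pt(2) x t1(2)] by blast+
    then have "\<not> x \<prec> u" "\<not> x \<prec> v" "x \<noteq> u" "x \<noteq> v"
      using less_asym less_trans[OF uv(1,2) xX(2)] less_irrefl uv by blast+
    then show ?thesis using XQ[OF xX(1)] B(2) A(2) xX(1) by blast
  qed
  moreover have "copy X" unfolding copy_def using emb X by blast
  moreover have "u \<in> elts X" "v \<in> elts X" using Pt X by blast+
  ultimately show ?thesis using XQ by blast
qed

end

section \<open>First differences and the colouring\<close>

text \<open>Kept apart from \<open>coded_order\<close>: the colouring has to be available before a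
  homogeneous set and its enumeration exist.\<close>

locale bit_coding = ZF mem for mem :: "'v \<Rightarrow> 'v \<Rightarrow> bool"  (infix "\<in>\<^sub>M" 50) +
  fixes less :: "'v \<Rightarrow> 'v \<Rightarrow> bool"  (infix "\<prec>" 50) and \<alpha> :: 'v and bit :: "'v \<Rightarrow> 'v \<Rightarrow> bool"
  assumes definable_less1: "definable (\<lambda>e. e 0 \<prec> e (Suc 0))"
    and definable_bit0: "definable (\<lambda>e. bit (e 0) (e (Suc 0)))"
    and ordinal: "is_ordinal \<alpha>"
begin

lemmas definable_bit = definable_subst2[of bit, OF definable_bit0]

definition agr :: "'v \<Rightarrow> 'v \<Rightarrow> 'v \<Rightarrow> bool" where
  "agr \<beta> x y \<longleftrightarrow> (\<forall>\<gamma>\<in>elts \<beta>. bit x \<gamma> \<longleftrightarrow> bit y \<gamma>)"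

text \<open>In the binary tree of codes, \<open>agr\<close> means passing through the same node at
  level \<open>\<beta>\<close>, and \<open>agr_thru\<close> also leaving it in the same
  direction.\<close>

definition agr_thru :: "'v \<Rightarrow> 'v \<Rightarrow> 'v \<Rightarrow> bool" where
  "agr_thru \<beta> x y \<longleftrightarrow> agr \<beta> x y \<and> (bit x \<beta> \<longleftrightarrow> bit y \<beta>)"

definition split_at :: "'v \<Rightarrow> 'v \<Rightarrow> 'v \<Rightarrow> bool" where
  "split_at \<beta> x y \<longleftrightarrow> \<beta> \<in> elts \<alpha> \<and> agr \<beta> x y \<and> \<not> (bit x \<beta> \<longleftrightarrow> bit y \<beta>)"

lemma definable_agr0: "definable (\<lambda>e. agr (e 0) (e (Suc 0)) (e (Suc (Suc 0))))"
  unfolding agr_def by (intro definable_logic definable_bit)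
lemmas definable_agr = definable_subst3[of agr, OF definable_agr0]

lemma definable_agr_thru0: "definable (\<lambda>e. agr_thru (e 0) (e (Suc 0)) (e (Suc (Suc 0))))"
  unfolding agr_thru_def by (intro definable_logic definable_bit definable_agr)
lemmas definable_agr_thru = definable_subst3[of agr_thru, OF definable_agr_thru0]

lemma definable_split_at0: "definable (\<lambda>e. split_at (e 0) (e (Suc 0)) (e (Suc (Suc 0))))"
  unfolding split_at_def by (intro definable_logic definable_bit definable_agr)
lemmas definable_split_at = definable_subst3[of split_at, OF definable_split_at0]

lemma ord_in: "\<beta> \<in> elts \<alpha> \<Longrightarrow> \<gamma> \<in> elts \<beta> \<Longrightarrow> \<gamma> \<in> elts \<alpha>"
  using ordinal unfolding is_ordinal_def by blast

lemma ord_irrefl: "\<beta> \<in> elts \<alpha> \<Longrightarrow> \<beta> \<notin> elts \<beta>"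
  using ordinal unfolding is_ordinal_def elts_def by blast

lemma ord_trans: "\<beta> \<in> elts \<alpha> \<Longrightarrow> \<gamma> \<in> elts \<beta> \<Longrightarrow> \<delta> \<in> elts \<gamma> \<Longrightarrow> \<delta> \<in> elts \<beta>"
proof -
  assume *: "\<beta> \<in> elts \<alpha>" "\<gamma> \<in> elts \<beta>" "\<delta> \<in> elts \<gamma>"
  then have "\<gamma> \<in> elts \<alpha>" "\<delta> \<in> elts \<alpha>" using ord_in by blast+
  moreover have "\<forall>x\<in>elts \<alpha>. \<forall>y\<in>elts \<alpha>. \<forall>z\<in>elts \<alpha>. x \<in>\<^sub>M y \<longrightarrow> y \<in>\<^sub>M z \<longrightarrow> x \<in>\<^sub>M z"
    using ordinal unfolding is_ordinal_def by blast
  ultimately show ?thesis using * unfolding elts_def by blast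
qed

lemma ord_linear: "\<beta> \<in> elts \<alpha> \<Longrightarrow> \<gamma> \<in> elts \<alpha> \<Longrightarrow> \<beta> \<in> elts \<gamma> \<or> \<beta> = \<gamma> \<or> \<gamma> \<in> elts \<beta>"
proof -
  assume *: "\<beta> \<in> elts \<alpha>" "\<gamma> \<in> elts \<alpha>"
  have "\<forall>x\<in>elts \<alpha>. \<forall>y\<in>elts \<alpha>. x \<in>\<^sub>M y \<or> x = y \<or> y \<in>\<^sub>M x"
    using ordinal unfolding is_ordinal_def by blast
  then show ?thesis using * unfolding elts_def by blast
qed

lemma ord_asym: "\<beta> \<in> elts \<alpha> \<Longrightarrow> \<gamma> \<in> elts \<beta> \<Longrightarrow> \<beta> \<notin> elts \<gamma>"
  using ord_trans ord_irrefl by blast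

lemma agr_sym: "agr \<beta> x y \<Longrightarrow> agr \<beta> y x"
  unfolding agr_def by blast

lemma agr_thru_refl: "agr_thru \<beta> x x"
  unfolding agr_thru_def agr_def by blast

lemma agr_thru_sym: "agr_thru \<beta> x y \<Longrightarrow> agr_thru \<beta> y x"
  unfolding agr_thru_def agr_def by blast

lemma agr_thru_trans: "agr_thru \<beta> x y \<Longrightarrow> agr_thru \<beta> y z \<Longrightarrow> agr_thru \<beta> x z"
  unfolding agr_thru_def agr_def by blast

lemma agr_thru_mono: "agr_thru \<beta> x y \<Longrightarrow> \<beta> \<in> elts \<alpha> \<Longrightarrow> \<gamma> \<in> elts \<beta> \<Longrightarrow> agr_thru \<gamma> x y"
  unfolding agr_thru_def agr_def using ord_trans by blast

lemma split_at_sym: "split_at \<beta> x y \<Longrightarrow> split_at \<beta> y x"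
  unfolding split_at_def agr_def by blast

lemma split_at_level: "split_at \<beta> x y \<Longrightarrow> \<beta> \<in> elts \<alpha>"
  unfolding split_at_def by blast

lemma agr_thru_split_at:
  assumes "agr_thru \<beta> x y" "split_at \<gamma> x y" "\<beta> \<in> elts \<alpha>"
  shows "\<beta> \<in> elts \<gamma>"
  using assms ord_linear[OF assms(3) split_at_level[OF assms(2)]]
  unfolding agr_thru_def split_at_def agr_def by blast

lemma split_at_unique: "split_at \<beta> x y \<Longrightarrow> split_at \<gamma> x y \<Longrightarrow> \<beta> = \<gamma>"
  using ord_linear[of \<beta> \<gamma>] unfolding split_at_def agr_def by blast

lemma not_agr_thru_same: "split_at \<beta> x y \<Longrightarrow> \<not> agr_thru \<beta> x y"
  unfolding split_at_def agr_thru_def by blast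

lemma split_at_cong: "split_at \<gamma> x y \<Longrightarrow> agr_thru \<gamma> y z \<Longrightarrow> split_at \<gamma> x z"
  unfolding split_at_def agr_thru_def agr_def by blast

lemma not_agr:
  assumes "\<not> agr \<beta> x y" "\<beta> \<in> elts \<alpha> \<or> \<beta> = \<alpha>"
  shows "\<exists>\<gamma>\<in>elts \<beta>. split_at \<gamma> x y"
proof -
  have sub: "\<gamma> \<in> elts \<alpha>" if "\<gamma> \<in> elts \<beta>" for \<gamma> using assms(2) that ord_in by blast
  obtain \<gamma> where \<gamma>: "\<gamma> \<in> elts \<beta>" "\<not> (bit x \<gamma> \<longleftrightarrow> bit y \<gamma>)" using assms(1) unfolding agr_def by blast
  have "definable (\<lambda>e. \<not> (bit x (e 0) \<longleftrightarrow> bit y (e 0)))" by (intro definable_logic definable_bit)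
  from minimal_ex[OF this \<gamma>] obtain \<delta> where \<delta>: "\<delta> \<in> elts \<beta>" "\<not> (bit x \<delta> \<longleftrightarrow> bit y \<delta>)"
    "\<And>\<epsilon>. \<epsilon> \<in> elts \<beta> \<Longrightarrow> \<epsilon> \<in> elts \<delta> \<Longrightarrow> (bit x \<epsilon> \<longleftrightarrow> bit y \<epsilon>)" by blast
  have "\<epsilon> \<in> elts \<beta>" if "\<epsilon> \<in> elts \<delta>" for \<epsilon>
    using assms(2) that \<delta>(1) ord_trans ord_in by blast
  then have "split_at \<delta> x y" unfolding split_at_def agr_def using \<delta> sub by blast
  then show ?thesis using \<delta>(1) by blast
qed

lemma not_agr_thru:
  assumes "\<not> agr_thru \<beta> x y" "\<beta> \<in> elts \<alpha>"
  shows "\<exists>\<gamma>. (\<gamma> \<in> elts \<beta> \<or> \<gamma> = \<beta>) \<and> split_at \<gamma> x y"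
proof (cases "agr \<beta> x y")
  case True
  then have "split_at \<beta> x y" using assms unfolding agr_thru_def split_at_def by blast
  then show ?thesis by blast
next
  case False
  then show ?thesis using not_agr assms(2) by blast
qed

text \<open>The two least elements of the set of all splitting levels of \<open>X\<close>.\<close>

definition first_levels :: "'v \<Rightarrow> 'v \<Rightarrow> 'v \<Rightarrow> bool" where
  "first_levels X \<delta> \<delta>' \<longleftrightarrow> \<delta> \<in> elts \<delta>' \<and> (\<exists>x\<in>elts X. \<exists>y\<in>elts X. split_at \<delta> x y) \<and>
     (\<exists>x\<in>elts X. \<exists>y\<in>elts X. split_at \<delta>' x y) \<and>
     (\<forall>x\<in>elts X. \<forall>y\<in>elts X. \<forall>\<gamma>. split_at \<gamma> x y \<longrightarrow> \<gamma> = \<delta> \<or> \<gamma> = \<delta>' \<or> \<delta>' \<in> elts \<gamma>)"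

text \<open>At its first splitting level \<open>\<delta>\<close>, \<open>X\<close> falls into two parts.  The colour asks whether the part that
  does not contain \<open>y\<close> lies entirely below the piece of \<open>y\<close> at the second level \<open>\<delta>'\<close>, for some
  \<open>y\<close> whose part is split at \<open>\<delta>'\<close>.\<close>

definition dominated :: "'v \<Rightarrow> 'v \<Rightarrow> 'v \<Rightarrow> bool" where
  "dominated X \<delta> \<delta>' \<longleftrightarrow> (\<exists>y\<in>elts X. (\<exists>y'\<in>elts X. split_at \<delta>' y y') \<and>
     (\<forall>z\<in>elts X. \<forall>x\<in>elts X. split_at \<delta> z y \<longrightarrow> agr_thru \<delta>' x y \<longrightarrow> z \<prec> x))"

definition colour :: "'v \<Rightarrow> bool" where
  "colour X \<longleftrightarrow> (\<exists>\<delta> \<delta>'. first_levels X \<delta> \<delta>' \<and> dominated X \<delta> \<delta>')"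

lemma definable_colour0: "definable (\<lambda>e. colour (e 0))"
  unfolding colour_def first_levels_def dominated_def
  by (intro definable_logic definable_split_at definable_agr_thru definable_subst2[OF definable_less1])

lemma first_levels_unique:
  assumes "first_levels X \<delta> \<delta>'" "first_levels X \<epsilon> \<epsilon>'"
  shows "\<delta> = \<epsilon> \<and> \<delta>' = \<epsilon>'"
proof -
  have o: "\<delta> \<in> elts \<alpha>" "\<delta>' \<in> elts \<alpha>" "\<epsilon> \<in> elts \<alpha>" "\<epsilon>' \<in> elts \<alpha>" "\<delta> \<in> elts \<delta>'" "\<epsilon> \<in> elts \<epsilon>'"
    using assms split_at_level unfolding first_levels_def by blast+
  have a: "\<delta> = \<epsilon> \<or> \<delta> = \<epsilon>' \<or> \<epsilon>' \<in> elts \<delta>" "\<delta>' = \<epsilon> \<or> \<delta>' = \<epsilon>' \<or> \<epsilon>' \<in> elts \<delta>'"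
    using assms unfolding first_levels_def by blast+
  have b: "\<epsilon> = \<delta> \<or> \<epsilon> = \<delta>' \<or> \<delta>' \<in> elts \<epsilon>" "\<epsilon>' = \<delta> \<or> \<epsilon>' = \<delta>' \<or> \<delta>' \<in> elts \<epsilon>'"
    using assms unfolding first_levels_def by blast+
  have "\<delta> = \<epsilon>"
  proof (rule ccontr)
    assume ne: "\<delta> \<noteq> \<epsilon>"
    have "\<epsilon> \<in> elts \<delta>" using a(1) ne o ord_trans[OF o(1)] by blast
    moreover have "\<delta> \<in> elts \<epsilon>" using b(1) ne o ord_trans[OF o(3)] by blast
    ultimately show False using ord_asym o by blast
  qed
  moreover have "\<delta>' = \<epsilon>'"
  proof (rule ccontr)
    assume ne: "\<delta>' \<noteq> \<epsilon>'"
    have "\<epsilon>' \<in> elts \<delta>'" using a(2) ne o \<open>\<delta> = \<epsilon>\<close> ord_irrefl by blast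
    moreover have "\<delta>' \<in> elts \<epsilon>'" using b(2) ne o \<open>\<delta> = \<epsilon>\<close> ord_irrefl by blast
    ultimately show False using ord_asym o by blast
  qed
  ultimately show ?thesis by blast
qed

text \<open>Uniqueness of the two levels lets the colour be evaluated at any pair that has been
  found.\<close>

lemma colour_iff: "first_levels X \<delta> \<delta>' \<Longrightarrow> colour X \<longleftrightarrow> dominated X \<delta> \<delta>'"
  unfolding colour_def using first_levels_unique by blast

end

section \<open>Both colours occur\<close>

locale coded_bits = coded_order mem w h less rk + bit_coding mem less \<alpha> bit
  for mem :: "'v \<Rightarrow> 'v \<Rightarrow> bool"  (infix "\<in>\<^sub>M" 50) and w h :: 'v
    and less :: "'v \<Rightarrow> 'v \<Rightarrow> bool"  (infix "\<prec>" 50) and rk \<alpha> and bit :: "'v \<Rightarrow> 'v \<Rightarrow> bool" +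
  assumes separated: "x \<in> elts h \<Longrightarrow> y \<in> elts h \<Longrightarrow> x \<noteq> y \<Longrightarrow> \<not> agr \<alpha> x y"
    and h_nonscattered: "nonscattered (\<lambda>x. x \<in> elts h)"
begin

text \<open>The positions relative to \<open>u\<close> and \<open>v\<close> are conjoined to the
  classes, so the order premises of \<open>copy_through_two_points\<close> hold
  automatically.\<close>

lemma copy_between:
  assumes "u \<in> elts h" "v \<in> elts h" "u \<prec> v" "nonscattered (\<lambda>x. A x \<and> x \<prec> u)"
    "nonscattered (\<lambda>x. B x \<and> u \<prec> x \<and> x \<prec> v)" "nonscattered (\<lambda>x. C x \<and> v \<prec> x)"
  shows "\<exists>X. copy X \<and> u \<in> elts X \<and> v \<in> elts X \<and>
    (\<forall>x\<in>elts X. x = u \<or> x = v \<or> A x \<and> x \<prec> u \<or> B x \<and> u \<prec> x \<and> x \<prec> v \<or> C x \<and> v \<prec> x) \<and>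
    (\<exists>x\<in>elts X. A x \<and> x \<prec> u) \<and> (\<exists>x\<in>elts X. C x \<and> v \<prec> x)"
  by (rule copy_through_two_points[OF h_nonscattered assms(1-4) _ assms(5) _ assms(6)]) blast+

definition levels_in :: "'v \<Rightarrow> 'v \<Rightarrow> bool" where
  "levels_in d \<beta> \<longleftrightarrow> (\<forall>x\<in>elts d. \<forall>y\<in>elts d. \<forall>\<gamma>. split_at \<gamma> x y \<longrightarrow> \<gamma> \<in> elts \<beta>)"

lemma definable_levels_in0: "definable (\<lambda>e. levels_in (e 0) (e (Suc 0)))"
  unfolding levels_in_def by (intro definable_logic definable_split_at)

lemma split_at_ex: "x \<in> elts h \<Longrightarrow> y \<in> elts h \<Longrightarrow> x \<noteq> y \<Longrightarrow> \<exists>\<gamma>. split_at \<gamma> x y"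
  using not_agr separated by blast

lemma nonscattered_within:
  assumes "nonscattered P" "\<And>x. P x \<Longrightarrow> x \<in> elts q"
  shows "\<exists>d. etalike d \<and> (\<forall>x\<in>elts d. x \<in> elts q \<and> P x)"
  using assms unfolding nonscattered_def by blast

end

text \<open>Minimality of \<open>\<mu>\<close> forces every copy of the rationals inside \<open>q\<close> to have a large class at
  each level below \<open>\<mu>\<close>: otherwise a transversal of the classes would be a counterexample.\<close>

locale minimal_level = coded_bits +
  fixes q \<mu> :: 'a
  assumes q: "etalike q"
    and levels: "levels_in q \<mu>"
    and \<mu>: "\<mu> \<in> elts \<alpha> \<or> \<mu> = \<alpha>"
    and minimal: "\<beta> \<in> elts \<mu> \<Longrightarrow> etalike d \<Longrightarrow> \<not> levels_in d \<beta>"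
begin

lemma below_\<mu>: "\<beta> \<in> elts \<mu> \<Longrightarrow> \<beta> \<in> elts \<alpha>"
  using \<mu> ord_in by blast

lemma qh: "x \<in> elts q \<Longrightarrow> x \<in> elts h"
  using etalike_subset[OF q] .

lemma level_in: "x \<in> elts q \<Longrightarrow> y \<in> elts q \<Longrightarrow> split_at \<gamma> x y \<Longrightarrow> \<gamma> \<in> elts \<mu>"
  using levels unfolding levels_in_def by blast

text \<open>If all classes of agreement below \<open>\<beta>\<close> were scattered in
  \<open>d\<close>, distinct points of a transversal would split below \<open>\<beta>\<close>,
  against the choice of \<mu>.\<close>

lemma large_class:
  assumes d: "etalike d" and dq: "\<And>x. x \<in> elts d \<Longrightarrow> x \<in> elts q" and \<beta>: "\<beta> \<in> elts \<mu>"
  shows "\<exists>x\<in>elts d. nonscattered (\<lambda>y. y \<in> elts d \<and> agr_thru \<beta> x y)"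
proof -
  have "\<exists>x\<in>elts d. nonscattered (\<lambda>y. y \<in> elts d \<and> agr \<beta> x y)"
  proof (rule ccontr)
    assume "\<not> ?thesis"
    then have small: "\<And>x. x \<in> elts d \<Longrightarrow> \<not> nonscattered (\<lambda>y. y \<in> elts d \<and> agr \<beta> x y)" by blast
    have "definable (\<lambda>e. agr \<beta> (e 0) (e (Suc 0)))"
      by (intro definable_agr is_term_var is_term_const)
    from transversal_ex[OF h_nonscattered d this agr_sym small] obtain c where
      c: "etalike c" "\<forall>x\<in>elts c. \<forall>y\<in>elts c. x \<noteq> y \<longrightarrow> \<not> agr \<beta> x y" by blast
    have "levels_in c \<beta>" unfolding levels_in_def
    proof (intro ballI allI impI)
      fix x y \<gamma> assume xy: "x \<in> elts c" "y \<in> elts c" "split_at \<gamma> x y"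
      then have "x \<noteq> y" unfolding split_at_def by blast
      then have "\<not> agr \<beta> x y" using c xy by blast
      then obtain \<delta> where "\<delta> \<in> elts \<beta>" "split_at \<delta> x y" using not_agr below_\<mu>[OF \<beta>] by blast
      then show "\<gamma> \<in> elts \<beta>" using split_at_unique xy(3) by blast
    qed
    then show False using minimal[OF \<beta> c(1)] by blast
  qed
  then obtain x where x: "nonscattered (\<lambda>y. y \<in> elts d \<and> agr \<beta> x y)" by blast
  \<comment> \<open>A class of agreement below \<open>\<beta>\<close> consists of at most two
    classes of agreement through \<open>\<beta>\<close>; one of them stays non-scattered.\<close>
  have "definable (\<lambda>e. bit (e 0) \<beta>)" by (intro definable_bit is_term_var is_term_const)
  from nonscattered_partition[OF x this] obtain P where
    P: "nonscattered P" "\<And>y z. P y \<Longrightarrow> P z \<Longrightarrow> y \<in> elts d \<and> z \<in> elts d \<and> agr \<beta> x y \<and> agr \<beta> x z \<and> (bit y \<beta> \<longleftrightarrow> bit z \<beta>)"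
  proof
    assume "nonscattered (\<lambda>y. (y \<in> elts d \<and> agr \<beta> x y) \<and> bit y \<beta>)"
    then show thesis by (rule that) blast
  next
    assume "nonscattered (\<lambda>y. (y \<in> elts d \<and> agr \<beta> x y) \<and> \<not> bit y \<beta>)"
    then show thesis by (rule that) blast
  qed
  obtain y where y: "P y" using nonscattered_two[OF P(1)] by blast
  have "agr_thru \<beta> y z" if "P z" for z
    using P(2)[OF y that] unfolding agr_thru_def agr_def by blast
  then have "nonscattered (\<lambda>z. z \<in> elts d \<and> agr_thru \<beta> y z)"
    using P by (intro nonscattered_mono[OF P(1)]) blast
  then show ?thesis using P(2)[OF y y] by blast
qed

lemma first_level:
  assumes d: "etalike d" and dq: "\<And>x. x \<in> elts d \<Longrightarrow> x \<in> elts q"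
  shows "\<exists>\<delta>\<in>elts \<mu>. (\<exists>u\<in>elts d. \<exists>v\<in>elts d. u \<prec> v \<and> split_at \<delta> u v) \<and>
    (\<forall>x\<in>elts d. \<forall>y\<in>elts d. \<forall>\<gamma>. split_at \<gamma> x y \<longrightarrow> \<gamma> = \<delta> \<or> \<delta> \<in> elts \<gamma>)"
proof -
  obtain x where x: "x \<in> elts d" using etalike_nonempty d by blast
  obtain y where y: "y \<in> elts d" "x \<prec> y" using etalike_above d x by blast
  have dh: "\<And>x. x \<in> elts d \<Longrightarrow> x \<in> elts h" using dq qh by blast
  have "x \<noteq> y" using y less_irrefl dh by blast
  then obtain \<beta> where \<beta>: "split_at \<beta> x y" using split_at_ex dh x y by blast
  have "definable (\<lambda>e. \<exists>x\<in>elts d. \<exists>y\<in>elts d. split_at (e 0) x y)"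
    by (intro definable_logic definable_split_at)
  from minimal_ex[OF this split_at_level[OF \<beta>]] \<beta> x y obtain \<delta> where
    \<delta>: "\<delta> \<in> elts \<alpha>" "\<exists>x\<in>elts d. \<exists>y\<in>elts d. split_at \<delta> x y"
    and min: "\<And>\<gamma>. \<gamma> \<in> elts \<alpha> \<Longrightarrow> \<exists>x\<in>elts d. \<exists>y\<in>elts d. split_at \<gamma> x y \<Longrightarrow> \<gamma> \<notin> elts \<delta>"
    by blast
  obtain u v where uv: "u \<in> elts d" "v \<in> elts d" "split_at \<delta> u v" using \<delta>(2) by blast
  have "u \<noteq> v" using uv(3) unfolding split_at_def by blast
  then have "\<exists>u\<in>elts d. \<exists>v\<in>elts d. u \<prec> v \<and> split_at \<delta> u v"
    using less_linear dh uv split_at_sym by blast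
  moreover have "\<gamma> = \<delta> \<or> \<delta> \<in> elts \<gamma>" if "x \<in> elts d" "y \<in> elts d" "split_at \<gamma> x y" for x y \<gamma>
    using min[of \<gamma>] that split_at_level[OF that(3)] ord_linear[OF \<delta>(1)] by blast
  moreover have "\<delta> \<in> elts \<mu>" using level_in dq uv by blast
  ultimately show ?thesis by blast
qed

text \<open>Mixed pairs split at \<open>\<beta>\<close>, pairs in \<open>Z\<close> only after
  \<open>\<delta>\<close>, and pairs in \<open>Y\<close> at \<open>\<delta>\<close> or later;
  \<open>u\<close> and \<open>v\<close> ensure that \<open>\<delta>\<close> occurs.\<close>

lemma two_sided_levels:
  assumes cover: "\<And>x. x \<in> elts X \<Longrightarrow> Z x \<or> Y x"
    and ZY: "\<And>x y. Z x \<Longrightarrow> Y y \<Longrightarrow> split_at \<beta> x y"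
    and Z: "\<And>x y. Z x \<Longrightarrow> Z y \<Longrightarrow> agr_thru \<delta> x y"
    and Y: "\<And>x y \<gamma>. Y x \<Longrightarrow> Y y \<Longrightarrow> split_at \<gamma> x y \<Longrightarrow> \<gamma> = \<delta> \<or> \<delta> \<in> elts \<gamma>"
    and uv: "u \<in> elts X" "v \<in> elts X" "Y u" "split_at \<delta> u v"
    and z: "z \<in> elts X" "Z z"
    and \<beta>\<delta>: "\<beta> \<in> elts \<delta>"
  shows "first_levels X \<beta> \<delta>"
proof -
  have \<delta>: "\<delta> \<in> elts \<alpha>" using uv split_at_level by blast
  have "\<gamma> = \<beta> \<or> \<gamma> = \<delta> \<or> \<delta> \<in> elts \<gamma>" if xy: "x \<in> elts X" "y \<in> elts X" "split_at \<gamma> x y" for x y \<gamma>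
  proof -
    consider "Z x" "Z y" | "Z x" "Y y" | "Y x" "Z y" | "Y x" "Y y" using cover xy by blast
    then show ?thesis
    proof cases
      case 1
      then show ?thesis using Z agr_thru_split_at xy(3) \<delta> by blast
    next
      case 2
      then show ?thesis using ZY split_at_unique xy(3) by blast
    next
      case 3
      then have "split_at \<beta> x y" using ZY split_at_sym by blast
      then show ?thesis using split_at_unique xy(3) by blast
    next
      case 4
      then show ?thesis using Y xy(3) by blast
    qed
  qed
  then show ?thesis unfolding first_levels_def using \<beta>\<delta> uv z ZY by blast
qed

text \<open>The part \<open>d\<close> lies below \<open>d'\<close>. For colour 1, \<open>d\<close>
  is thinned to a class agreeing through the first splitting level of \<open>d'\<close>, so the
  upper part splits next. For colour 0 the roles are exchanged, and the part that does not split
  next lies above.\<close>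

lemma splitting_case:
  assumes d: "etalike d" "\<And>x. x \<in> elts d \<Longrightarrow> x \<in> elts q"
    and d': "etalike d'" "\<And>x. x \<in> elts d' \<Longrightarrow> x \<in> elts q"
    and split: "\<And>x y. x \<in> elts d \<Longrightarrow> y \<in> elts d' \<Longrightarrow> x \<prec> y \<and> split_at \<beta> x y"
    and agr: "\<And>x y. x \<in> elts d \<Longrightarrow> y \<in> elts d \<Longrightarrow> agr_thru \<beta> x y"
    and agr': "\<And>x y. x \<in> elts d' \<Longrightarrow> y \<in> elts d' \<Longrightarrow> agr_thru \<beta> x y"
    and \<beta>: "\<beta> \<in> elts \<alpha>"
  shows "(\<exists>X. copy X \<and> colour X) \<and> (\<exists>X. copy X \<and> \<not> colour X)"
proof
  have dh: "\<And>x. x \<in> elts d \<Longrightarrow> x \<in> elts h" and dh': "\<And>x. x \<in> elts d' \<Longrightarrow> x \<in> elts h"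
    using d(2) d'(2) qh by blast+
  show "\<exists>X. copy X \<and> colour X"
  proof -
    obtain \<delta> u v where \<delta>: "\<delta> \<in> elts \<mu>" and uv: "u \<in> elts d'" "v \<in> elts d'" "u \<prec> v" "split_at \<delta> u v"
      and min: "\<And>x y \<gamma>. x \<in> elts d' \<Longrightarrow> y \<in> elts d' \<Longrightarrow> split_at \<gamma> x y \<Longrightarrow> \<gamma> = \<delta> \<or> \<delta> \<in> elts \<gamma>"
      using first_level[OF d'] by blast
    have \<beta>\<delta>: "\<beta> \<in> elts \<delta>" using agr_thru_split_at[OF agr' uv(4) \<beta>] uv by blast
    have \<delta>\<alpha>: "\<delta> \<in> elts \<alpha>" using below_\<mu> \<delta> .
    obtain x where x: "x \<in> elts d" "nonscattered (\<lambda>y. y \<in> elts d \<and> agr_thru \<delta> x y)"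
      using large_class[OF d \<delta>] by blast
    define Z where "Z = (\<lambda>y. y \<in> elts d \<and> agr_thru \<delta> x y)"
    have Z: "nonscattered (\<lambda>y. Z y \<and> y \<prec> u)"
      by (rule nonscattered_mono[OF x(2)]) (use split uv in \<open>simp add: Z_def\<close>)
    from copy_between[OF dh'[OF uv(1)] dh'[OF uv(2)] uv(3) Z
        nonscattered_interval[OF d'(1) uv(1-3)] nonscattered_above[OF d'(1) uv(2)]]
    obtain X where X: "copy X" "u \<in> elts X" "v \<in> elts X" "\<exists>z\<in>elts X. Z z \<and> z \<prec> u"
      and "\<forall>y\<in>elts X. y = u \<or> y = v \<or> Z y \<and> y \<prec> u \<or> y \<in> elts d' \<and> u \<prec> y \<and> y \<prec> v \<or> y \<in> elts d' \<and> v \<prec> y"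
      by (elim exE conjE)
    then have cover: "Z y \<or> y \<in> elts d'" if "y \<in> elts X" for y using that uv(1,2) by auto
    obtain z where z: "z \<in> elts X" "Z z" using X(4) by blast
    have "first_levels X \<beta> \<delta>"
    proof (rule two_sided_levels[OF cover _ _ min X(2,3) uv(1,4) z \<beta>\<delta>])
      show "split_at \<beta> x y" if "Z x" "y \<in> elts d'" for x y using split that unfolding Z_def by blast
      show "agr_thru \<delta> x y" if "Z x" "Z y" for x y
        using that agr_thru_sym agr_thru_trans unfolding Z_def by blast
    qed
    moreover have "dominated X \<beta> \<delta>" unfolding dominated_def
    \<comment> \<open>The witness is \<open>u\<close>, which splits from \<open>v\<close> at
      \<open>\<delta>\<close>. Its piece lies in \<open>d'\<close> and the other part in
      \<open>d\<close>.\<close>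
    proof (intro bexI conjI ballI impI)
      fix z y assume zy: "z \<in> elts X" "y \<in> elts X" "split_at \<beta> z u" "agr_thru \<delta> y u"
      have "z \<notin> elts d'" using zy(3) agr'[OF _ uv(1)] not_agr_thru_same by blast
      then have "z \<in> elts d" using cover[OF zy(1)] unfolding Z_def by blast
      moreover have "y \<notin> elts d"
      proof
        assume "y \<in> elts d"
        then have "split_at \<beta> y u" using split uv(1) by blast
        then have "\<delta> \<in> elts \<beta>" using agr_thru_split_at zy(4) \<delta>\<alpha> by blast
        then show False using \<beta>\<delta> ord_asym \<beta> by blast
      qed
      then have "y \<in> elts d'" using cover[OF zy(2)] unfolding Z_def by blast
      ultimately show "z \<prec> y" using split by blast
    qed (use X uv in blast)+
    ultimately show ?thesis using X(1) colour_iff by blast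
  qed
  show "\<exists>X. copy X \<and> \<not> colour X"
  proof -
    obtain \<delta> u v where \<delta>: "\<delta> \<in> elts \<mu>" and uv: "u \<in> elts d" "v \<in> elts d" "u \<prec> v" "split_at \<delta> u v"
      and min: "\<And>x y \<gamma>. x \<in> elts d \<Longrightarrow> y \<in> elts d \<Longrightarrow> split_at \<gamma> x y \<Longrightarrow> \<gamma> = \<delta> \<or> \<delta> \<in> elts \<gamma>"
      using first_level[OF d] by blast
    have \<beta>\<delta>: "\<beta> \<in> elts \<delta>" using agr_thru_split_at[OF agr uv(4) \<beta>] uv by blast
    have \<delta>\<alpha>: "\<delta> \<in> elts \<alpha>" using below_\<mu> \<delta> .
    obtain x where x: "x \<in> elts d'" "nonscattered (\<lambda>y. y \<in> elts d' \<and> agr_thru \<delta> x y)"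
      using large_class[OF d' \<delta>] by blast
    define Z where "Z = (\<lambda>y. y \<in> elts d' \<and> agr_thru \<delta> x y)"
    have Z: "nonscattered (\<lambda>y. Z y \<and> v \<prec> y)"
      by (rule nonscattered_mono[OF x(2)]) (use split uv in \<open>simp add: Z_def\<close>)
    from copy_between[OF dh[OF uv(1)] dh[OF uv(2)] uv(3)
        nonscattered_below[OF d(1) uv(1)] nonscattered_interval[OF d(1) uv(1-3)] Z]
    obtain X where X: "copy X" "u \<in> elts X" "v \<in> elts X" "\<exists>z\<in>elts X. Z z \<and> v \<prec> z"
      and "\<forall>y\<in>elts X. y = u \<or> y = v \<or> y \<in> elts d \<and> y \<prec> u \<or> y \<in> elts d \<and> u \<prec> y \<and> y \<prec> v \<or> Z y \<and> v \<prec> y"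
      by (elim exE conjE)
    then have cover: "Z y \<or> y \<in> elts d" if "y \<in> elts X" for y using that uv(1,2) by auto
    obtain z where z: "z \<in> elts X" "Z z" using X(4) by blast
    have ZZ: "agr_thru \<delta> x y" if "Z x" "Z y" for x y
      using that agr_thru_sym agr_thru_trans unfolding Z_def by blast
    have Zd: "y \<prec> x \<and> split_at \<beta> x y" if "Z x" "y \<in> elts d" for x y
      using split that split_at_sym unfolding Z_def by blast
    have fl: "first_levels X \<beta> \<delta>"
      by (rule two_sided_levels[OF cover _ ZZ min X(2,3) uv(1,4) z \<beta>\<delta>]) (use Zd in blast)+
    have "\<not> dominated X \<beta> \<delta>"
    proof
      assume "dominated X \<beta> \<delta>"
      then obtain y y' where y: "y \<in> elts X" "y' \<in> elts X" "split_at \<delta> y y'"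
        and dom: "\<And>z x. z \<in> elts X \<Longrightarrow> x \<in> elts X \<Longrightarrow> split_at \<beta> z y \<Longrightarrow> agr_thru \<delta> x y \<Longrightarrow> z \<prec> x"
        unfolding dominated_def by blast
      \<comment> \<open>A witness must be split at \<open>\<delta>\<close>, which does not happen on
        the \<open>Z\<close> side. So the other part contains \<open>z\<close>, which lies above
        \<open>y\<close>.\<close>
      have "y \<in> elts d"
      proof (rule ccontr)
        assume "y \<notin> elts d"
        then have Zy: "Z y" using cover y by blast
        show False
        proof (cases "Z y'")
          case True
          then show False using ZZ Zy y(3) not_agr_thru_same by blast
        next
          case False
          then have "split_at \<beta> y y'" using cover y(2) Zd[OF Zy] by blast
          then show False using split_at_unique y(3) \<beta>\<delta> ord_irrefl \<beta> by blast
        qed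
      qed
      then have "z \<prec> y" "y \<prec> z" using dom[OF z(1) y(1)] Zd[OF z(2)] agr_thru_refl by blast+
      then show False
        using less_asym dh \<open>y \<in> elts d\<close> z(2) dh' unfolding Z_def by blast
    qed
    then show ?thesis using X(1) colour_iff fl by blast
  qed
qed

text \<open>Each level below \<mu> has exactly one large class, and these form a decreasing chain.
  Two points that leave the chain one after the other, together with points from a still later
  class, have their first two splitting levels at the two exits.\<close>

lemma separating_case:
  assumes sep: "\<And>x y \<beta>. x \<in> elts q \<Longrightarrow> y \<in> elts q \<Longrightarrow> split_at \<beta> x y \<Longrightarrow>
      nonscattered (\<lambda>z. z \<in> elts q \<and> agr_thru \<beta> x z) \<Longrightarrow> \<not> nonscattered (\<lambda>z. z \<in> elts q \<and> agr_thru \<beta> y z)"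
  shows "(\<exists>X. copy X \<and> colour X) \<and> (\<exists>X. copy X \<and> \<not> colour X)"
proof -
  \<comment> \<open>The point \<open>n\<close> stands for its class through level
    \<open>\<beta>\<close>; no representative has to be chosen for all levels at once.\<close>
  define big where "big n \<beta> \<longleftrightarrow> nonscattered (\<lambda>z. z \<in> elts q \<and> agr_thru \<beta> n z)" for n \<beta>
  have sep': "\<not> big y \<beta>" if "x \<in> elts q" "y \<in> elts q" "split_at \<beta> x y" "big x \<beta>" for x y \<beta>
    using sep that unfolding big_def by blast
  have big_mono: "big n \<gamma>" if "big n \<beta>" "\<beta> \<in> elts \<mu>" "\<gamma> \<in> elts \<beta>" for n \<beta> \<gamma>
    using that(1) agr_thru_mono[OF _ below_\<mu>[OF that(2)] that(3)]
    unfolding big_def by (auto elim: nonscattered_mono)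
  have big_cong: "big m \<beta>" if "big n \<beta>" "agr_thru \<beta> n m" for n m \<beta>
    using that(1) agr_thru_trans[OF agr_thru_sym[OF that(2)]]
    unfolding big_def by (auto elim: nonscattered_mono)
  \<comment> \<open>At the first difference of two large classes both sides would be non-scattered,
    contrary to \<open>sep\<close>.\<close>
  have big_unique: "agr_thru \<beta> n m"
    if nm: "n \<in> elts q" "m \<in> elts q" "\<beta> \<in> elts \<mu>" "big n \<beta>" "big m \<beta>" for n m \<beta>
  proof (rule ccontr)
    assume "\<not> agr_thru \<beta> n m"
    then obtain \<gamma> where \<gamma>: "\<gamma> \<in> elts \<beta> \<or> \<gamma> = \<beta>" "split_at \<gamma> n m"
      using not_agr_thru below_\<mu> nm(3) by blast
    then have "big n \<gamma>" "big m \<gamma>" using big_mono nm by blast+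
    then show False using sep' nm \<gamma>(2) by blast
  qed
  have big_ex: "\<exists>n\<in>elts q. big n \<beta>" if "\<beta> \<in> elts \<mu>" for \<beta>
    using large_class[OF q _ that] unfolding big_def by blast
  \<comment> \<open>A class large in \<open>d\<close> is large in \<open>q\<close>, so by uniqueness
    it is the class of \<open>n\<close>: every copy of the rationals in \<open>q\<close> meets the
    chain in a non-scattered set.\<close>
  have big_in: "nonscattered (\<lambda>z. z \<in> elts d \<and> agr_thru \<beta> n z)"
    if d: "etalike d" "\<And>x. x \<in> elts d \<Longrightarrow> x \<in> elts q" and n: "n \<in> elts q" "\<beta> \<in> elts \<mu>" "big n \<beta>" for d n \<beta>
  proof -
    obtain x where x: "x \<in> elts d" "nonscattered (\<lambda>y. y \<in> elts d \<and> agr_thru \<beta> x y)"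
      using large_class[OF d n(2)] by blast
    have "big x \<beta>" unfolding big_def by (rule nonscattered_mono[OF x(2)]) (use d in blast)
    then have "agr_thru \<beta> n x" using big_unique n d(2) x(1) by blast
    then show ?thesis by (intro nonscattered_mono[OF x(2)]) (use agr_thru_trans in blast)
  qed
  \<comment> \<open>Bad points never leave the chain. There is at most one, so a point that does
    leave can be found in any non-scattered part of \<open>q\<close>.\<close>
  define bad where "bad x \<longleftrightarrow> (\<forall>\<beta>\<in>elts \<mu>. big x \<beta>)" for x
  have bad_unique: "x = y" if xy: "x \<in> elts q" "y \<in> elts q" "bad x" "bad y" for x y
  proof (rule ccontr)
    assume "x \<noteq> y"
    then obtain \<gamma> where \<gamma>: "split_at \<gamma> x y" using split_at_ex qh xy by blast
    then have "\<gamma> \<in> elts \<mu>" using level_in xy by blast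
    then show False using sep' \<gamma> xy unfolding bad_def by blast
  qed
  have good_ex: "\<exists>x. P x \<and> \<not> bad x" if P: "nonscattered P" "\<And>x. P x \<Longrightarrow> x \<in> elts q" for P
  proof -
    obtain x y where xy: "P x" "P y" "x \<prec> y" using nonscattered_two[OF P(1)] by blast
    then have "x \<noteq> y" using less_irrefl P qh by blast
    then show ?thesis using bad_unique xy P by blast
  qed
  obtain x0 where x0: "x0 \<in> elts q" "\<not> bad x0" using good_ex[OF nonscattered_etalike[OF q]] by blast
  obtain \<beta>0 where \<beta>0: "\<beta>0 \<in> elts \<mu>" "\<not> big x0 \<beta>0" using x0 unfolding bad_def by blast
  obtain n0 where n0: "n0 \<in> elts q" "big n0 \<beta>0" using big_ex \<beta>0 by blast
  have next_point: "\<exists>\<beta>1 n1 \<delta> \<delta>'. \<beta>1 \<in> elts \<mu> \<and> n1 \<in> elts q \<and> big n1 \<beta>1 \<and> \<delta> \<in> elts \<delta>' \<and> split_at \<delta> x0 x1 \<and>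
      (\<delta>' \<in> elts \<beta>1 \<or> \<delta>' = \<beta>1) \<and>
      (\<forall>z\<in>elts q. agr_thru \<beta>1 n1 z \<longrightarrow> split_at \<delta> x0 z \<and> split_at \<delta>' x1 z)"
    if x1: "x1 \<in> elts q" "agr_thru \<beta>0 n0 x1" "\<not> bad x1" for x1
  proof -
    obtain \<beta>1 where \<beta>1: "\<beta>1 \<in> elts \<mu>" "\<not> big x1 \<beta>1" using x1 unfolding bad_def by blast
    obtain n1 where n1: "n1 \<in> elts q" "big n1 \<beta>1" using big_ex \<beta>1 by blast
    have big1: "big x1 \<beta>0" using big_cong n0 x1 by blast
    have \<beta>01: "\<beta>0 \<in> elts \<beta>1"
      using ord_linear[OF below_\<mu>[OF \<beta>0(1)] below_\<mu>[OF \<beta>1(1)]] big1 \<beta>1 big_mono[OF big1 \<beta>0(1)] by blast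
    have n01: "agr_thru \<beta>0 n1 n0"
      using big_unique[OF n1(1) n0(1) \<beta>0(1) big_mono[OF n1(2) \<beta>1(1) \<beta>01] n0(2)] .
    have "\<not> agr_thru \<beta>0 x0 n0" using big_cong[OF n0(2)] agr_thru_sym \<beta>0(2) by blast
    then obtain \<delta> where \<delta>: "\<delta> \<in> elts \<beta>0 \<or> \<delta> = \<beta>0" "split_at \<delta> x0 n0"
      using not_agr_thru below_\<mu>[OF \<beta>0(1)] by blast
    have "\<not> agr_thru \<beta>1 x1 n1" using big_cong[OF n1(2)] agr_thru_sym \<beta>1(2) by blast
    then obtain \<delta>' where \<delta>': "\<delta>' \<in> elts \<beta>1 \<or> \<delta>' = \<beta>1" "split_at \<delta>' x1 n1"
      using not_agr_thru below_\<mu>[OF \<beta>1(1)] by blast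
    have "agr_thru \<beta>0 x1 n1" using x1(2) n01 agr_thru_sym agr_thru_trans by blast
    \<comment> \<open>\<open>x0\<close> has left the chain by level \<open>\<beta>0\<close>, whereas
      \<open>x1\<close> still agrees with it through \<open>\<beta>0\<close>; hence its exit level
      \<open>\<delta>'\<close> is later than \<open>\<delta>\<close>.\<close>
    then have "\<beta>0 \<in> elts \<delta>'" using agr_thru_split_at \<delta>'(2) below_\<mu>[OF \<beta>0(1)] by blast
    then have \<delta>\<delta>': "\<delta> \<in> elts \<delta>'" using \<delta>(1) ord_trans[OF split_at_level[OF \<delta>'(2)]] by blast
    have 0: "split_at \<delta> x0 z" if "agr_thru \<beta>0 n0 z" for z
    proof -
      have "agr_thru \<delta> n0 z" using that agr_thru_mono[OF that below_\<mu>[OF \<beta>0(1)]] \<delta>(1) by blast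
      then show ?thesis using split_at_cong[OF \<delta>(2)] by blast
    qed
    have 1: "split_at \<delta>' x1 z" if "agr_thru \<beta>1 n1 z" for z
    proof -
      have "agr_thru \<delta>' n1 z" using that agr_thru_mono[OF that below_\<mu>[OF \<beta>1(1)]] \<delta>'(1) by blast
      then show ?thesis using split_at_cong[OF \<delta>'(2)] by blast
    qed
    have "split_at \<delta> x0 z" if "agr_thru \<beta>1 n1 z" for z
    proof (rule 0)
      have "agr_thru \<beta>0 n1 z" using agr_thru_mono[OF that below_\<mu>[OF \<beta>1(1)] \<beta>01] .
      then show "agr_thru \<beta>0 n0 z" using n01 agr_thru_sym agr_thru_trans by blast
    qed
    then show ?thesis using \<beta>1(1) n1 \<delta>\<delta>' 0[OF x1(2)] \<delta>'(1) 1 by blast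
  qed
  \<comment> \<open>At \<open>\<delta>\<close> the point \<open>x0\<close> is cut off alone; at
    \<open>\<delta>'\<close> the remainder falls into \<open>x1\<close> alone and the rest. The
    piece of \<open>x1\<close> dominates \<open>x0\<close> exactly if \<open>x0 \<prec> x1\<close>.
    The other piece never does, because it contains \<open>a\<close>, which lies below
    \<open>x0\<close>.\<close>
  have result: "colour X \<longleftrightarrow> x0 \<prec> x1"
    if X: "x0 \<in> elts X" "x1 \<in> elts X"
        "\<And>x. x \<in> elts X \<Longrightarrow> x = x0 \<or> x = x1 \<or> x \<in> elts q \<and> agr_thru \<beta>1 n1 x"
      and a: "a \<in> elts X" "a \<in> elts q" "agr_thru \<beta>1 n1 a" "a \<prec> x0"
      and x1: "x1 \<in> elts q"
      and \<beta>1: "\<beta>1 \<in> elts \<mu>" and \<delta>: "\<delta> \<in> elts \<delta>'" "split_at \<delta> x0 x1" "\<delta>' \<in> elts \<beta>1 \<or> \<delta>' = \<beta>1"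
      and far: "\<And>z. z \<in> elts q \<Longrightarrow> agr_thru \<beta>1 n1 z \<Longrightarrow> split_at \<delta> x0 z \<and> split_at \<delta>' x1 z"
    for X x1 a \<beta>1 n1 \<delta> \<delta>'
  proof -
    have \<delta>\<alpha>: "\<delta> \<in> elts \<alpha>" "\<delta>' \<in> elts \<alpha>" using \<delta>(2) far[OF a(2,3)] split_at_level by blast+
    have ne: "\<delta> \<noteq> \<delta>'" "\<delta>' \<notin> elts \<delta>" using \<delta>(1) \<delta>\<alpha> ord_irrefl ord_asym by blast+
    have rest: "agr_thru \<delta>' x y"
      if "agr_thru \<beta>1 n1 x" "agr_thru \<beta>1 n1 y" for x y
    proof -
      have "agr_thru \<beta>1 x y" using that agr_thru_sym agr_thru_trans by blast
      then show ?thesis using \<delta>(3) agr_thru_mono below_\<mu>[OF \<beta>1] by blast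
    qed
    have x0_split: "split_at \<delta> x0 x" if "x \<in> elts X" "x \<noteq> x0" for x
      using X(3)[OF that(1)] that(2) far \<delta>(2) by blast
    have fl: "first_levels X \<delta> \<delta>'" unfolding first_levels_def
    proof (intro conjI ballI allI impI)
      show "\<exists>x\<in>elts X. \<exists>y\<in>elts X. split_at \<delta> x y" using X \<delta> by blast
      show "\<exists>x\<in>elts X. \<exists>y\<in>elts X. split_at \<delta>' x y" using X a far by blast
      fix x y \<gamma> assume xy: "x \<in> elts X" "y \<in> elts X" "split_at \<gamma> x y"
      then have "x \<noteq> y" unfolding split_at_def by blast
      show "\<gamma> = \<delta> \<or> \<gamma> = \<delta>' \<or> \<delta>' \<in> elts \<gamma>"
      proof (cases "x = x0 \<or> y = x0")
        case True
        then have "split_at \<delta> x y" using x0_split xy \<open>x \<noteq> y\<close> split_at_sym by blast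
        then show ?thesis using split_at_unique xy(3) by blast
      next
        case False
        show ?thesis
        proof (cases "x = x1 \<or> y = x1")
          case True
          then have "split_at \<delta>' x y" using False X(3) xy \<open>x \<noteq> y\<close> far split_at_sym by metis
          then show ?thesis using split_at_unique xy(3) by blast
        next
          case f: False
          then have "agr_thru \<delta>' x y" using False X(3) xy rest by blast
          then show ?thesis using agr_thru_split_at xy(3) \<delta>\<alpha> by blast
        qed
      qed
    qed (rule \<delta>(1))
    have "dominated X \<delta> \<delta>' \<longleftrightarrow> x0 \<prec> x1"
    proof
      assume "x0 \<prec> x1"
      show "dominated X \<delta> \<delta>'" unfolding dominated_def
      proof (intro bexI conjI ballI impI)
        show "split_at \<delta>' x1 a" using far a by blast
        fix z x assume zx: "z \<in> elts X" "x \<in> elts X" "split_at \<delta> z x1" "agr_thru \<delta>' x x1"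
        have "z = x0"
        proof (rule ccontr)
          assume "z \<noteq> x0"
          moreover have "z \<noteq> x1" using zx(3) unfolding split_at_def by blast
          ultimately have "split_at \<delta>' x1 z" using X(3)[OF zx(1)] far by blast
          then show False using zx(3) split_at_sym split_at_unique ne by blast
        qed
        moreover have "x = x1"
        proof (rule ccontr)
          assume x: "x \<noteq> x1"
          have "x \<noteq> x0" using agr_thru_split_at[OF zx(4) _ \<delta>\<alpha>(2), of \<delta>] \<delta>(2) ne by blast
          then have "split_at \<delta>' x1 x" using X(3)[OF zx(2)] far x by blast
          then show False using zx(4) split_at_sym not_agr_thru_same by blast
        qed
        ultimately show "z \<prec> x" using \<open>x0 \<prec> x1\<close> by blast
      qed (use X a in blast)+
    next
      assume "dominated X \<delta> \<delta>'"
      then obtain y y' where y: "y \<in> elts X" "y' \<in> elts X" "split_at \<delta>' y y'"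
        and dom: "\<And>z x. z \<in> elts X \<Longrightarrow> x \<in> elts X \<Longrightarrow> split_at \<delta> z y \<Longrightarrow> agr_thru \<delta>' x y \<Longrightarrow> z \<prec> x"
        unfolding dominated_def by blast
      have "y' \<noteq> y" using y(3) unfolding split_at_def by blast
      then have "y \<noteq> x0" using x0_split[OF y(2)] y(3) split_at_unique ne by blast
      then have s: "split_at \<delta> x0 y" using x0_split y(1) by blast
      show "x0 \<prec> x1"
      proof (cases "y = x1")
        case True
        then show ?thesis using dom[OF X(1,2) s] agr_thru_refl by blast
      next
        case False
        then have "agr_thru \<delta>' a y" using X(3)[OF y(1)] \<open>y \<noteq> x0\<close> rest[OF a(3)] by blast
        then have "x0 \<prec> a" using dom[OF X(1) a(1) s] by blast
        then show ?thesis using less_asym qh a x0 by blast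
      qed
    qed
    then show ?thesis using colour_iff[OF fl] by blast
  qed
  show ?thesis
  proof
    show "\<exists>X. copy X \<and> colour X"
    proof -
      obtain d where d: "etalike d" "\<forall>x\<in>elts d. x \<in> elts q \<and> x0 \<prec> x"
        using nonscattered_within[OF nonscattered_above[OF q x0(1)], of q] by blast
      have "nonscattered (\<lambda>z. z \<in> elts d \<and> agr_thru \<beta>0 n0 z)" using big_in[OF d(1)] d n0 \<beta>0 by blast
      from good_ex[OF this] d obtain x1 where
        x1: "x1 \<in> elts q" "x0 \<prec> x1" "agr_thru \<beta>0 n0 x1" "\<not> bad x1" by blast
      from next_point[OF x1(1,3,4)] obtain \<beta>1 n1 \<delta> \<delta>' where
        n1: "\<beta>1 \<in> elts \<mu>" "n1 \<in> elts q" "big n1 \<beta>1" "\<delta> \<in> elts \<delta>'" "split_at \<delta> x0 x1" "\<delta>' \<in> elts \<beta>1 \<or> \<delta>' = \<beta>1"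
        and far: "\<forall>z\<in>elts q. agr_thru \<beta>1 n1 z \<longrightarrow> split_at \<delta> x0 z \<and> split_at \<delta>' x1 z" by blast
      define K where "K z \<longleftrightarrow> z \<in> elts q \<and> agr_thru \<beta>1 n1 z" for z
      \<comment> \<open>By \<open>big_in\<close> any non-scattered part of \<open>q\<close> stays
        non-scattered when cut down to the large class through \<open>\<beta>1\<close>, so all three
        intervals can be filled from that class.\<close>
      have K: "nonscattered (\<lambda>z. K z \<and> R z)" if R: "nonscattered (\<lambda>z. z \<in> elts q \<and> R z)" for R
      proof -
        obtain d where d: "etalike d" "\<forall>x\<in>elts d. x \<in> elts q \<and> (x \<in> elts q \<and> R x)"
          using nonscattered_within[OF R, of q] by blast
        have "nonscattered (\<lambda>z. z \<in> elts d \<and> agr_thru \<beta>1 n1 z)" using big_in[OF d(1)] d n1 by blast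
        then show ?thesis by (rule nonscattered_mono) (use d in \<open>auto simp: K_def\<close>)
      qed
      from copy_between[OF qh[OF x0(1)] qh[OF x1(1)] x1(2)
          K[OF nonscattered_below[OF q x0(1)]] K[OF nonscattered_interval[OF q x0(1) x1(1,2)]]
          K[OF nonscattered_above[OF q x1(1)]]]
      obtain X where X: "copy X" "x0 \<in> elts X" "x1 \<in> elts X"
        and cover: "\<forall>x\<in>elts X. x = x0 \<or> x = x1 \<or> K x \<and> x \<prec> x0 \<or> K x \<and> x0 \<prec> x \<and> x \<prec> x1 \<or> K x \<and> x1 \<prec> x"
        and "\<exists>x\<in>elts X. K x \<and> x \<prec> x0" by (elim exE conjE)
      then obtain a where a: "a \<in> elts X" "K a" "a \<prec> x0" by blast
      have "colour X \<longleftrightarrow> x0 \<prec> x1"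
        by (rule result[OF X(2,3) _ a(1) _ _ a(3) x1(1) n1(1,4,5,6)])
          (use cover a(2) far in \<open>auto simp: K_def\<close>)
      then show ?thesis using X(1) x1(2) by blast
    qed
    show "\<exists>X. copy X \<and> \<not> colour X"
    proof -
      obtain d where d: "etalike d" "\<forall>x\<in>elts d. x \<in> elts q \<and> x \<prec> x0"
        using nonscattered_within[OF nonscattered_below[OF q x0(1)], of q] by blast
      have "nonscattered (\<lambda>z. z \<in> elts d \<and> agr_thru \<beta>0 n0 z)" using big_in[OF d(1)] d n0 \<beta>0 by blast
      from good_ex[OF this] d obtain x1 where
        x1: "x1 \<in> elts q" "x1 \<prec> x0" "agr_thru \<beta>0 n0 x1" "\<not> bad x1" by blast
      from next_point[OF x1(1,3,4)] obtain \<beta>1 n1 \<delta> \<delta>' where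
        n1: "\<beta>1 \<in> elts \<mu>" "n1 \<in> elts q" "big n1 \<beta>1" "\<delta> \<in> elts \<delta>'" "split_at \<delta> x0 x1" "\<delta>' \<in> elts \<beta>1 \<or> \<delta>' = \<beta>1"
        and far: "\<forall>z\<in>elts q. agr_thru \<beta>1 n1 z \<longrightarrow> split_at \<delta> x0 z \<and> split_at \<delta>' x1 z" by blast
      define K where "K z \<longleftrightarrow> z \<in> elts q \<and> agr_thru \<beta>1 n1 z" for z
      have K: "nonscattered (\<lambda>z. K z \<and> R z)" if R: "nonscattered (\<lambda>z. z \<in> elts q \<and> R z)" for R
      proof -
        obtain d where d: "etalike d" "\<forall>x\<in>elts d. x \<in> elts q \<and> (x \<in> elts q \<and> R x)"
          using nonscattered_within[OF R, of q] by blast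
        have "nonscattered (\<lambda>z. z \<in> elts d \<and> agr_thru \<beta>1 n1 z)" using big_in[OF d(1)] d n1 by blast
        then show ?thesis by (rule nonscattered_mono) (use d in \<open>auto simp: K_def\<close>)
      qed
      from copy_between[OF qh[OF x1(1)] qh[OF x0(1)] x1(2)
          K[OF nonscattered_below[OF q x1(1)]] K[OF nonscattered_interval[OF q x1(1) x0(1) x1(2)]]
          K[OF nonscattered_above[OF q x0(1)]]]
      obtain X where X: "copy X" "x1 \<in> elts X" "x0 \<in> elts X"
        and cover: "\<forall>x\<in>elts X. x = x1 \<or> x = x0 \<or> K x \<and> x \<prec> x1 \<or> K x \<and> x1 \<prec> x \<and> x \<prec> x0 \<or> K x \<and> x0 \<prec> x"
        and "\<exists>x\<in>elts X. K x \<and> x \<prec> x1" by (elim exE conjE)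
      then obtain a where a: "a \<in> elts X" "K a" "a \<prec> x1" by blast
      have "a \<in> elts q" using a(2) unfolding K_def by blast
      \<comment> \<open>Here \<open>x1\<close> is the lower of the two points, so \<open>a\<close>
        is found below \<open>x1\<close>; \<open>result\<close> asks for a point below
        \<open>x0\<close>.\<close>
      then have ax0: "a \<prec> x0" using less_trans[of a x1 x0] a(3) x1 x0(1) qh by blast
      have "colour X \<longleftrightarrow> x0 \<prec> x1"
        by (rule result[OF X(3,2) _ a(1) _ _ ax0 x1(1) n1(1,4,5,6)])
          (use cover a(2) far in \<open>auto simp: K_def\<close>)
      then show ?thesis using X(1) x1(1,2) less_asym qh x0(1) by blast
    qed
  qed
qed

lemma both_colours: "(\<exists>X. copy X \<and> colour X) \<and> (\<exists>X. copy X \<and> \<not> colour X)"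
proof (cases "\<exists>x\<in>elts q. \<exists>y\<in>elts q. \<exists>\<beta>. split_at \<beta> x y \<and>
    nonscattered (\<lambda>z. z \<in> elts q \<and> agr_thru \<beta> x z) \<and> nonscattered (\<lambda>z. z \<in> elts q \<and> agr_thru \<beta> y z)")
  case False
  then show ?thesis by (intro separating_case) blast
next
  case True
  then obtain x y \<beta> where xy: "x \<in> elts q" "y \<in> elts q" "split_at \<beta> x y"
    "nonscattered (\<lambda>z. z \<in> elts q \<and> agr_thru \<beta> x z)" "nonscattered (\<lambda>z. z \<in> elts q \<and> agr_thru \<beta> y z)" by blast
  have \<beta>: "\<beta> \<in> elts \<alpha>" using split_at_level xy(3) .
  \<comment> \<open>Stated for arbitrary \<open>x\<close>, \<open>y\<close>, \<open>c\<close>, since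
    \<open>nonscattered_separate\<close> may put either side below.\<close>
  have main: ?thesis
    if xy: "split_at \<beta> x y" "nonscattered (\<lambda>z. (z \<in> elts q \<and> agr_thru \<beta> x z) \<and> z \<prec> c)"
      "nonscattered (\<lambda>z. (z \<in> elts q \<and> agr_thru \<beta> y z) \<and> c \<prec> z)" and c: "c \<in> elts h" for x y c
  proof -
    obtain d where d: "etalike d" "\<And>z. z \<in> elts d \<Longrightarrow> z \<in> elts q \<and> agr_thru \<beta> x z \<and> z \<prec> c"
      using xy(2) unfolding nonscattered_def by blast
    obtain d' where d': "etalike d'" "\<And>z. z \<in> elts d' \<Longrightarrow> z \<in> elts q \<and> agr_thru \<beta> y z \<and> c \<prec> z"
      using xy(3) unfolding nonscattered_def by blast
    have agr_d: "agr_thru \<beta> a b" if "a \<in> elts d" "b \<in> elts d" for a b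
      using d(2)[OF that(1)] d(2)[OF that(2)] agr_thru_trans[OF agr_thru_sym] by blast
    have agr_d': "agr_thru \<beta> a b" if "a \<in> elts d'" "b \<in> elts d'" for a b
      using d'(2)[OF that(1)] d'(2)[OF that(2)] agr_thru_trans[OF agr_thru_sym] by blast
    show ?thesis
    proof (rule splitting_case[OF d(1) _ d'(1) _ _ _ _ \<beta>])
      fix a b assume ab: "a \<in> elts d" "b \<in> elts d'"
      have "a \<prec> b" using less_trans[OF _ c] ab d d' qh by blast
      moreover have thru: "agr_thru \<beta> x a" "agr_thru \<beta> y b" using d(2)[OF ab(1)] d'(2)[OF ab(2)] by simp_all
      have "split_at \<beta> y a" by (rule split_at_cong[OF split_at_sym[OF xy(1)] thru(1)])
      then have "split_at \<beta> a b" by (rule split_at_cong[OF split_at_sym thru(2)])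
      ultimately show "a \<prec> b \<and> split_at \<beta> a b" ..
    qed (use d(2) d'(2) agr_d agr_d' in simp_all)
  qed
  from nonscattered_separate[OF xy(4,5)] show ?thesis using main xy(3) split_at_sym by blast
qed

end

section \<open>Existence of the minimal level\<close>

context coded_bits
begin

theorem both_colours_occur: "(\<exists>X. copy X \<and> colour X) \<and> (\<exists>X. copy X \<and> \<not> colour X)"
proof -
  have "\<exists>q \<mu>. etalike q \<and> levels_in q \<mu> \<and> (\<mu> \<in> elts \<alpha> \<or> \<mu> = \<alpha>) \<and>
    (\<forall>\<beta> d. \<beta> \<in> elts \<mu> \<longrightarrow> etalike d \<longrightarrow> \<not> levels_in d \<beta>)"
  \<comment> \<open>If no level below \<alpha> bounds the splittings of a copy of the rationals,
    \<alpha> itself serves as \<open>\<mu>\<close>, because all splitting levels lie in it.\<close>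
  proof (cases "\<exists>\<beta>\<in>elts \<alpha>. \<exists>d. etalike d \<and> levels_in d \<beta>")
    case True
    then obtain \<beta> where \<beta>: "\<beta> \<in> elts \<alpha>" "\<exists>d. etalike d \<and> levels_in d \<beta>" by blast
    have "definable (\<lambda>e. \<exists>d. etalike d \<and> levels_in d (e 0))"
      by (intro definable_logic definable_etalike definable_subst2[OF definable_levels_in0])
    from minimal_ex[OF this \<beta>] show ?thesis using ord_in by blast
  next
    case False
    obtain q where q: "etalike q" using h_nonscattered unfolding nonscattered_def by blast
    have "levels_in q \<alpha>" unfolding levels_in_def using split_at_level by blast
    then show ?thesis using q False by blast
  qed
  then obtain q \<mu> where *: "etalike q" "levels_in q \<mu>" "\<mu> \<in> elts \<alpha> \<or> \<mu> = \<alpha>"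
    "\<And>\<beta> d. \<beta> \<in> elts \<mu> \<Longrightarrow> etalike d \<Longrightarrow> \<not> levels_in d \<beta>" by blast
  interpret minimal_level mem w h less rk \<alpha> bit q \<mu>
    by unfold_locales (use * in auto)
  show ?thesis by (rule both_colours)
qed

end

section \<open>Transfer to the partition relation\<close>

context coded_order
begin

lemma embedding_reflects:
  assumes P: "embedding P" and rel: "related P t x" "related P t' x'"
  shows "(t \<prec> t' \<longleftrightarrow> x \<prec> x') \<and> (t = t' \<longleftrightarrow> x = x')"
proof -
  have h: "t \<in> elts h" "x \<in> elts h" "t' \<in> elts h" "x' \<in> elts h"
    using embedding_related[OF P] rel by blast+
  have mono: "(t = t' \<longrightarrow> x = x') \<and> (t \<prec> t' \<longrightarrow> x \<prec> x')" "t' \<prec> t \<longrightarrow> x' \<prec> x"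
    using P rel unfolding embedding_def by blast+
  show ?thesis
    using less_linear[OF h(1,3)] mono less_irrefl[OF h(2)] less_asym[OF h(2,4)]
      less_irrefl[OF h(1)] less_asym[OF h(1,3)] by auto
qed

end

context ZF
begin

lemma is_function_related:
  assumes "is_function f A B" "related f x y"
  shows "x \<in> A \<and> y \<in> B"
proof -
  have "\<forall>p\<in>elts f. \<exists>x\<in>A. \<exists>y\<in>B. is_pair p x y" using assms(1) unfolding is_function_def by blast
  then show ?thesis using assms(2) pair_inject unfolding related_def by blast
qed

lemma is_function_unique: "is_function f A B \<Longrightarrow> x \<in> A \<Longrightarrow> related f x y \<Longrightarrow> related f x y' \<Longrightarrow> y = y'"
  unfolding is_function_def by blast

lemma is_function_value: "is_function f A B \<Longrightarrow> x \<in> A \<Longrightarrow> \<exists>y\<in>B. related f x y"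
  using is_function_related unfolding is_function_def by blast

section \<open>Definable colourings as sets of the model\<close>

lemma definable_order_isomorphic0: "definable (\<lambda>e. order_isomorphic (e 0) r T s)"
  unfolding order_isomorphic_def is_bijection_def is_injection_def is_function_def Ex1_def
  by (intro definable_logic definable_related definable_is_pair)

lemma two_set: "\<exists>t. elts t = two"
proof -
  obtain z where z: "elts z = {}" using empty_ex by blast
  obtain o' where o': "elts o' = {z, z}" using pairing by blast
  obtain t where t: "elts t = {z, o'}" using pairing by blast
  have "c \<in> elts t \<longleftrightarrow> c \<in> two" for c
  proof
    assume "c \<in> elts t"
    then have "c = z \<or> c = o'" unfolding t by blast
    then show "c \<in> two" unfolding two_def using z o' by fastforce
  next
    assume "c \<in> two"
    then consider "elts c = {}" | y where "elts y = {}" "elts c = {y}" unfolding two_def by blast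
    then show "c \<in> elts t"
    proof cases
      case 1
      then have "elts c = elts z" unfolding z .
      then have "c = z" by (rule extensionality)
      then show ?thesis unfolding t by simp
    next
      case 2
      then have "elts y = elts z" unfolding z by simp
      then have "y = z" by (rule extensionality)
      then have "elts c = elts o'" unfolding o' 2(2) by simp
      then have "c = o'" by (rule extensionality)
      then show ?thesis unfolding t by simp
    qed
  qed
  then show ?thesis by blast
qed

lemma two_unique:
  assumes "c \<in> two" "c' \<in> two" "(\<exists>z. z \<in> elts c) \<longleftrightarrow> (\<exists>z. z \<in> elts c')"
  shows "c = c'"
proof (rule extensionality)
  have eq: "y = y'" if "elts y = {}" "elts y' = {}" for y y'
    by (rule extensionality) (simp add: that)
  consider "elts c = {}" "elts c' = {}" | y y' where "elts y = {}" "elts c = {y}" "elts y' = {}" "elts c' = {y'}"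
    using assms unfolding two_def by auto
  then show "elts c = elts c'" by cases (use eq in auto)
qed

lemma two_value: "\<exists>c\<in>two. (\<exists>z. z \<in> elts c) \<longleftrightarrow> b"
proof -
  obtain z where z: "elts z = {}" using empty_ex by blast
  obtain o' where o': "elts o' = {z, z}" using pairing by blast
  have "z \<in> two" "o' \<in> two" unfolding two_def using z o' by fastforce+
  moreover have "\<not> (\<exists>x. x \<in> elts z)" "\<exists>x. x \<in> elts o'" unfolding z o' by blast+
  ultimately show ?thesis by (cases b) blast+
qed

text \<open>\<open>arrow\<close> quantifies over colourings that are sets of the model.
  Comprehension realises a definable \<open>P\<close> as such a set, with inhabitedness of the
  colour as its truth value.\<close>

lemma homogeneous_for_predicate:
  assumes arrow: "arrow L r T s" and P: "definable (\<lambda>e. P (e 0))"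
  shows "\<exists>H\<in>subsets_of_type L r T s.
    (\<forall>X\<in>subsets_of_type H r T s. P X) \<or> (\<forall>X\<in>subsets_of_type H r T s. \<not> P X)"
proof -
  obtain pw where pw: "elts pw = subsets L" using power_set by blast
  obtain tw where tw: "elts tw = two" using two_set by blast
  have "definable (\<lambda>e. order_isomorphic (e 0) r T s \<and> ((\<exists>z. z \<in> elts (e (Suc 0))) \<longleftrightarrow> P (e 0)))"
    by (intro definable_logic definable_subst1[OF definable_order_isomorphic0] definable_subst1[OF P])
  from relation_comprehension[OF this, of pw tw] obtain F where
    pairs: "\<forall>p\<in>elts F. \<exists>X\<in>elts pw. \<exists>c\<in>elts tw. is_pair p X c"
    and rel: "\<forall>X c. related F X c \<longleftrightarrow> X \<in> elts pw \<and> c \<in> elts tw \<and>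
        order_isomorphic X r T s \<and> ((\<exists>z. z \<in> elts c) \<longleftrightarrow> P X)"
    by (elim exE conjE)
  have rel': "related F X c \<longleftrightarrow> X \<in> subsets_of_type L r T s \<and> c \<in> two \<and> ((\<exists>z. z \<in> elts c) \<longleftrightarrow> P X)" for X c
    by (auto simp: rel subsets_of_type_def pw tw)
  have "is_function F (subsets_of_type L r T s) two" unfolding is_function_def
  proof (intro conjI ballI)
    fix p assume p: "p \<in> elts F"
    then obtain X c where "is_pair p X c" using pairs by blast
    moreover from this have "related F X c" unfolding related_def using p by blast
    ultimately show "\<exists>x\<in>subsets_of_type L r T s. \<exists>y\<in>two. is_pair p x y" unfolding rel' by blast
  next
    fix X assume X: "X \<in> subsets_of_type L r T s"
    obtain c where c: "c \<in> two" "(\<exists>z. z \<in> elts c) \<longleftrightarrow> P X" using two_value by blast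
    show "\<exists>!c. related F X c"
    proof
      show "related F X c" using X c unfolding rel' by blast
      fix c' assume "related F X c'"
      then show "c' = c" using c unfolding rel' by (intro two_unique) blast+
    qed
  qed
  then obtain H c where H: "H \<in> subsets_of_type L r T s"
    "\<And>X. X \<in> subsets_of_type H r T s \<Longrightarrow> related F X c"
    using arrow unfolding arrow_def by blast
  then have "P X \<longleftrightarrow> (\<exists>z. z \<in> elts c)" if "X \<in> subsets_of_type H r T s" for X
    using that unfolding rel' by blast
  then show ?thesis using H(1) by blast
qed

theorem no_arrow:
  assumes T: "lin_order T s" "countable T" "\<not> scattered T s"
    and L: "lin_order L r"
    and \<alpha>: "is_ordinal \<alpha>" and f: "is_injection f (elts L) (subsets \<alpha>)"
  shows "\<not> arrow L r T s"
proof
  assume arrow: "arrow L r T s"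
  define bit where "bit x \<gamma> \<longleftrightarrow> (\<exists>y. related f x y \<and> \<gamma> \<in> elts y)" for x \<gamma>
  have r_definable: "definable (\<lambda>e. related r (e 0) (e (Suc 0)))"
    by (intro definable_related is_term_var is_term_const)
  have bit_definable: "definable (\<lambda>e. bit (e 0) (e (Suc 0)))"
    unfolding bit_def by (intro definable_logic definable_related)
  \<comment> \<open>Done before \<open>H\<close> is obtained: the colouring depends on
    \<open>r\<close>, \<open>f\<close> and \<alpha> only.\<close>
  interpret bit_coding mem "related r" \<alpha> bit
    by unfold_locales (fact r_definable bit_definable \<alpha>)+
  obtain H where H: "H \<in> subsets_of_type L r T s"
    and hom: "(\<forall>X\<in>subsets_of_type H r T s. colour X) \<or> (\<forall>X\<in>subsets_of_type H r T s. \<not> colour X)"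
    using homogeneous_for_predicate[OF arrow definable_colour0] by blast
  have HL: "x \<in> elts L" if "x \<in> elts H" for x
    using H that unfolding subsets_of_type_def subsets_def by blast
  obtain g where g: "is_bijection g (elts H) (elts T)"
    and g_less: "\<forall>x\<in>elts H. \<forall>x'\<in>elts H. \<forall>y y'. related g x y \<longrightarrow> related g x' y' \<longrightarrow>
        (related r x x' \<longleftrightarrow> related s y y')"
    using H unfolding subsets_of_type_def order_isomorphic_def by blast
  have gf: "is_function g (elts H) (elts T)"
    and g_inj: "\<And>x x' y. related g x y \<Longrightarrow> related g x' y \<Longrightarrow> x = x'"
    and g_surj: "\<And>y. y \<in> elts T \<Longrightarrow> \<exists>x. related g x y"
    using g is_function_related unfolding is_bijection_def is_injection_def by blast+
  note gHT = is_function_related[OF gf]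
  obtain w c where w: "is_omega w" and c: "is_injection c (elts T) (elts w)"
    using T(2) unfolding countable_def by blast
  have cf: "is_function c (elts T) (elts w)"
    and c_inj: "\<And>x x' y. related c x y \<Longrightarrow> related c x' y \<Longrightarrow> x = x'"
    using c is_function_related unfolding is_injection_def by blast+
  have ff: "is_function f (elts L) (subsets \<alpha>)"
    and f_inj: "\<And>x x' y. related f x y \<Longrightarrow> related f x' y \<Longrightarrow> x = x'"
    using f is_function_related unfolding is_injection_def by blast+
  \<comment> \<open>The enumeration of \<open>T\<close> is pulled back to \<open>H\<close> along the
    isomorphism \<open>g\<close>.\<close>
  define rk where "rk x n \<longleftrightarrow> (\<exists>t. related g x t \<and> related c t n)" for x n
  interpret coded_order mem w H "related r" rk
  proof
    show "is_omega w" by (fact w)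
    show "definable (\<lambda>e. related r (e 0) (e (Suc 0)))" by (fact r_definable)
    show "definable (\<lambda>e. rk (e 0) (e (Suc 0)))"
      unfolding rk_def by (intro definable_logic definable_related)
    show "\<And>x. x \<in> elts H \<Longrightarrow> \<not> related r x x"
      using L HL unfolding lin_order_def by blast
    show "\<And>x y z. x \<in> elts H \<Longrightarrow> y \<in> elts H \<Longrightarrow> z \<in> elts H \<Longrightarrow>
        related r x y \<Longrightarrow> related r y z \<Longrightarrow> related r x z"
      using L HL unfolding lin_order_def by blast
    show "\<And>x y. x \<in> elts H \<Longrightarrow> y \<in> elts H \<Longrightarrow> related r x y \<or> x = y \<or> related r y x"
      using L HL unfolding lin_order_def by blast
    show "\<And>x. x \<in> elts H \<Longrightarrow> \<exists>n\<in>elts w. rk x n"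
      using is_function_value[OF gf] is_function_value[OF cf] unfolding rk_def by blast
    show "\<And>x n m. x \<in> elts H \<Longrightarrow> rk x n \<Longrightarrow> rk x m \<Longrightarrow> n = m"
      using is_function_unique[OF gf] is_function_unique[OF cf] gHT unfolding rk_def by blast
    show "\<And>x y n. x \<in> elts H \<Longrightarrow> y \<in> elts H \<Longrightarrow> rk x n \<Longrightarrow> rk y n \<Longrightarrow> x = y"
      using c_inj g_inj unfolding rk_def by blast
  qed
  have h_nonscattered: "nonscattered (\<lambda>x. x \<in> elts H)"
  proof -
    obtain D a b where D: "\<And>t. t \<in> elts D \<Longrightarrow> t \<in> elts T" "a \<in> elts D" "b \<in> elts D" "a \<noteq> b"
      and dense: "densely_ordered D s"
      using T(3) unfolding scattered_def subsets_def by blast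
    have lin: "x \<in> elts D \<Longrightarrow> y \<in> elts D \<Longrightarrow> related s x y \<or> x = y \<or> related s y x" for x y
      using T(1) D(1) unfolding lin_order_def by blast
    have tr: "x \<in> elts D \<Longrightarrow> y \<in> elts D \<Longrightarrow> z \<in> elts D \<Longrightarrow> related s x y \<Longrightarrow> related s y z \<Longrightarrow> related s x z" for x y z
      using T(1) D(1) unfolding lin_order_def by blast
    obtain u v where uv: "u \<in> elts D" "v \<in> elts D" "related s u v" using D lin by blast
    have betw: "\<exists>z\<in>elts D. related s x z \<and> related s z y"
      if "x \<in> elts D" "y \<in> elts D" "related s x y" for x y
      using dense that unfolding densely_ordered_def by blast
    \<comment> \<open>\<open>D\<close> may have endpoints; restricting to the points strictly
      between \<open>u\<close> and \<open>v\<close> removes them, and \<open>g\<close> carries the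
      interval back to \<open>H\<close>.\<close>
    have "definable (\<lambda>e. \<exists>t\<in>elts D. related g (e 0) t \<and> related s u t \<and> related s t v)"
      by (intro definable_logic definable_related)
    from comprehension[OF this] obtain d where
      d: "elts d = {x \<in> elts H. \<exists>t\<in>elts D. related g x t \<and> related s u t \<and> related s t v}" by blast
    have lift: "\<exists>x\<in>elts d. related g x t" if "t \<in> elts D" "related s u t" "related s t v" for t
      using g_surj[OF D(1)[OF that(1)]] gHT that unfolding d by blast
    have "etalike d" unfolding etalike_def
    proof (intro conjI ballI impI)
      show "\<exists>x. x \<in> elts d" using betw[OF uv] lift by blast
      fix x assume x: "x \<in> elts d"
      then obtain t where t: "x \<in> elts H" "t \<in> elts D" "related g x t" "related s u t" "related s t v"
        unfolding d by blast
      show "x \<in> elts H" by (fact t(1))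
      obtain l where l: "l \<in> elts D" "related s u l" "related s l t"
        using betw[OF uv(1) t(2,4)] by blast
      then obtain y where "y \<in> elts d" "related g y l" using lift tr[OF l(1) t(2) uv(2)] t(5) by blast
      then show "\<exists>y\<in>elts d. related r y x" using g_less gHT l(3) t(3) by blast
      obtain m where m: "m \<in> elts D" "related s t m" "related s m v"
        using betw[OF t(2) uv(2) t(5)] by blast
      then obtain y where "y \<in> elts d" "related g y m" using lift tr[OF uv(1) t(2) m(1)] t(4) by blast
      then show "\<exists>y\<in>elts d. related r x y" using g_less gHT m(2) t(3) by blast
      fix y assume y: "y \<in> elts d" "related r x y"
      then obtain t' where t': "t' \<in> elts D" "related g y t'" "related s u t'" "related s t' v"
        unfolding d by blast
      have "related s t t'" using g_less gHT t(3) t'(2) y(2) by blast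
      then obtain k where k: "k \<in> elts D" "related s t k" "related s k t'"
        using betw t(2) t'(1) by blast
      then have "related s u k" "related s k v" using tr uv t t' by blast+
      then obtain z where "z \<in> elts d" "related g z k" using lift k(1) by blast
      then show "\<exists>z\<in>elts d. related r x z \<and> related r z y"
        using g_less gHT k(2,3) t(3) t'(2) by blast
    qed
    then show ?thesis unfolding nonscattered_def using etalike_subset by blast
  qed
  interpret coded_bits mem w H "related r" rk \<alpha> bit
  proof
    show "nonscattered (\<lambda>x. x \<in> elts H)" by (fact h_nonscattered)
    fix x y assume xy: "x \<in> elts H" "y \<in> elts H" "x \<noteq> y"
    obtain a where a: "related f x a" "elts a \<subseteq> elts \<alpha>"
      using is_function_value[OF ff HL[OF xy(1)]] unfolding subsets_def by blast
    obtain b where b: "related f y b" "elts b \<subseteq> elts \<alpha>"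
      using is_function_value[OF ff HL[OF xy(2)]] unfolding subsets_def by blast
    have uniq: "related f x c \<longleftrightarrow> c = a" "related f y c \<longleftrightarrow> c = b" for c
      using a(1) b(1) is_function_unique[OF ff HL[OF xy(1)]] is_function_unique[OF ff HL[OF xy(2)]]
      by metis+
    have bits: "bit x \<gamma> \<longleftrightarrow> \<gamma> \<in> elts a" "bit y \<gamma> \<longleftrightarrow> \<gamma> \<in> elts b" for \<gamma>
      unfolding bit_def uniq by simp_all
    show "\<not> agr \<alpha> x y"
    proof
      assume "agr \<alpha> x y"
      then have "elts a = elts b" using a(2) b(2) unfolding agr_def bits by blast
      then have "a = b" by (rule extensionality)
      then show False using f_inj a(1) b(1) xy(3) by blast
    qed
  qed
  \<comment> \<open>The isomorphism \<open>k\<close> from \<open>X\<close> to \<open>T\<close> is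
    the inverse of the embedding \<open>P\<close> followed by \<open>g\<close>; it is
    order-preserving both ways since an embedding of a linear order reflects the order.\<close>
  have type: "X \<in> subsets_of_type H r T s" if cp: "copy X" for X
  proof -
    obtain P where P: "embedding P" and X: "\<And>x. x \<in> elts X \<longleftrightarrow> (\<exists>t. related P t x)"
      using cp unfolding copy_def by blast
    have XH: "elts X \<subseteq> elts H" using copy_subset[OF cp] by blast
    have P_total: "\<exists>x. related P t x" if "t \<in> elts H" for t
      using P that unfolding embedding_def by blast
    note P_refl = embedding_reflects[OF P] and P_in = embedding_related[OF P]
    have "definable (\<lambda>e. \<exists>y. related P y (e 0) \<and> related g y (e (Suc 0)))"
      by (intro definable_logic definable_related)
    from relation_comprehension[OF this, of X T] obtain k where
      pairs: "\<forall>p\<in>elts k. \<exists>x\<in>elts X. \<exists>t\<in>elts T. is_pair p x t"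
      and k: "\<forall>x t. related k x t \<longleftrightarrow> x \<in> elts X \<and> t \<in> elts T \<and> (\<exists>y. related P y x \<and> related g y t)"
      by (elim exE conjE)
    have k': "related k x t \<longleftrightarrow> (\<exists>y. related P y x \<and> related g y t)" for x t
      using k X gHT by blast
    have fn: "is_function k (elts X) (elts T)" unfolding is_function_def
    proof (intro conjI ballI)
      fix p assume "p \<in> elts k"
      then show "\<exists>x\<in>elts X. \<exists>t\<in>elts T. is_pair p x t" using pairs by blast
    next
      fix x assume "x \<in> elts X"
      then obtain y where y: "related P y x" using X by blast
      then obtain t where t: "related g y t" using is_function_value[OF gf] P_in by blast
      show "\<exists>!t. related k x t"
      proof
        show "related k x t" using k' y t by blast
        fix t' assume "related k x t'"
        then obtain y' where y': "related P y' x" "related g y' t'" using k' by blast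
        then have "y' = y" using P_refl y by blast
        then show "t' = t" using is_function_unique[OF gf] y' t gHT by blast
      qed
    qed
    have "is_bijection k (elts X) (elts T)"
      unfolding is_bijection_def is_injection_def
    proof (intro conjI ballI allI impI)
      show "is_function k (elts X) (elts T)" by (fact fn)
      fix x x' t assume "related k x t" "related k x' t"
      then obtain y y' where "related P y x" "related g y t" "related P y' x'" "related g y' t"
        unfolding k' by blast
      then show "x = x'" using g_inj P_refl by blast
    next
      fix t assume "t \<in> elts T"
      then obtain y where y: "related g y t" using g_surj by blast
      then obtain x where "related P y x" using P_total gHT by blast
      then show "\<exists>x\<in>elts X. related k x t" using y k' X by blast
    qed
    moreover have "related r x x' \<longleftrightarrow> related s t t'" if xt: "related k x t" "related k x' t'" for x x' t t'
    proof -
      obtain y y' where y: "related P y x" "related g y t" "related P y' x'" "related g y' t'"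
        using xt unfolding k' by blast
      then have "related r x x' \<longleftrightarrow> related r y y'" using P_refl[OF y(1,3)] by blast
      also have "\<dots> \<longleftrightarrow> related s t t'" using g_less gHT y(2,4) by blast
      finally show ?thesis .
    qed
    ultimately have "order_isomorphic X r T s" unfolding order_isomorphic_def by blast
    then show ?thesis unfolding subsets_of_type_def subsets_def using XH by blast
  qed
  from both_colours_occur hom type show False by blast
qed

end

theorem theorem11:
  fixes mem :: "'v \<Rightarrow> 'v \<Rightarrow> bool" and T s L r :: 'v
  assumes "ZF mem"
    and "set_structure.lin_order mem T s"
    and "set_structure.countable mem T"
    and "\<not> set_structure.scattered mem T s"
    and "set_structure.lin_order mem L r"
    and "\<exists>\<alpha> f. set_structure.is_ordinal mem \<alpha> \<and>
           set_structure.is_injection mem f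
             (set_structure.elts mem L) (set_structure.subsets mem \<alpha>)"
  shows "\<not> set_structure.arrow mem L r T s"
  using ZF.no_arrow[OF assms(1-5)] assms(6) by blast

end
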